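(* For every $n \ge 1$ there exists an $n$--cohesive set $B$ with $B \le_T 0^{(n)}$.
   Context: $[\omega]^n$ is the class of $n$--element subsets of $\omega$. A $2$--coloring $\mathcal{C}:[\omega]^n\to\{0,1\}$ is computably enumerable if one of its color classes is c.e. under a standard coding. $A$ is almost homogeneous for $\mathcal{C}$ if there is a finite $F$ with $\mathcal{C}$ constant on $[A\setminus F]^n$. An infinite set $A$ is $n$--cohesive if it is almost homogeneous for every computably enumerable $2$--coloring of $[\omega]^n$. $0^{(n)}$ is the $n$-th Turing jump of $\emptyset$. *)

theory Defs
  imports Main "HOL-Library.FuncSet" "HOL-Library.Nat_Bijection" "HOL-Library.Ramsey"
begin

text \<open>
  Oracle computability is Kleene's: the least class of partial functions containing the basic
  functions and the oracle, and closed under composition, primitive recursion and minimization.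
  All functions are unary; several arguments are passed through the Cantor pairing
  \<^const>\<open>prod_encode\<close>, whose projections and tupling are therefore among the basic operations.
\<close>

datatype prog =
    Zero
  | Succ
  | Fst
  | Snd
  | Oracle
  | Tup prog prog
  | Comp prog prog
  | Prec prog prog
  | Mu prog

text \<open>\<open>eval A p x y\<close>: program \<open>p\<close> with oracle \<open>A\<close> halts on input \<open>x\<close> with output \<open>y\<close>.\<close>

inductive eval :: "nat set \<Rightarrow> prog \<Rightarrow> nat \<Rightarrow> nat \<Rightarrow> bool" for A :: "nat set" where
  eval_Zero: "eval A Zero x 0"
| eval_Succ: "eval A Succ x (Suc x)"
| eval_Fst: "eval A Fst x (fst (prod_decode x))"
| eval_Snd: "eval A Snd x (snd (prod_decode x))"
| eval_Oracle: "eval A Oracle x (if x \<in> A then 1 else 0)"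
| eval_Tup: "eval A p x y \<Longrightarrow> eval A q x z \<Longrightarrow> eval A (Tup p q) x (prod_encode (y, z))"
| eval_Comp: "eval A q x y \<Longrightarrow> eval A p y z \<Longrightarrow> eval A (Comp p q) x z"
| eval_Prec_0: "eval A p x y \<Longrightarrow> eval A (Prec p q) (prod_encode (x, 0)) y"
| eval_Prec_Suc:
    "eval A (Prec p q) (prod_encode (x, k)) y \<Longrightarrow>
     eval A q (prod_encode (x, prod_encode (k, y))) z \<Longrightarrow>
     eval A (Prec p q) (prod_encode (x, Suc k)) z"
| eval_Mu:
    "eval A p (prod_encode (x, k)) 0 \<Longrightarrow>
     (\<forall>j<k. \<exists>y. eval A p (prod_encode (x, j)) (Suc y)) \<Longrightarrow>
     eval A (Mu p) x k"

inductive_cases eval_elims: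
  "eval A Zero x y" "eval A Succ x y" "eval A Fst x y" "eval A Snd x y" "eval A Oracle x y"
  "eval A (Tup p q) x y" "eval A (Comp p q) x y"
  "eval A (Prec p q) x y" "eval A (Mu p) x y"

lemma eval_deterministic: "eval A p x y \<Longrightarrow> eval A p x z \<Longrightarrow> y = z"
proof (induction arbitrary: z rule: eval.induct)
  case (eval_Tup p x y q z')
  from eval_Tup.prems show ?case
    by (rule eval_elims(6)) (use eval_Tup.IH in blast)
next
  case (eval_Comp q x y p z')
  from eval_Comp.prems show ?case
    by (rule eval_elims(7)) (use eval_Comp.IH in blast)
next
  case (eval_Prec_0 p x y q)
  from eval_Prec_0.prems show ?case
    by (rule eval_elims(8)) (use eval_Prec_0.IH in auto)
next
  case (eval_Prec_Suc p q x k y z')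
  from eval_Prec_Suc.prems show ?case
  proof (rule eval_elims(8))
    fix x' k' y'
    assume eq: "prod_encode (x, Suc k) = prod_encode (x', Suc k')"
      and 1: "eval A (Prec p q) (prod_encode (x', k')) y'"
      and 2: "eval A q (prod_encode (x', prod_encode (k', y'))) z"
    from eq have "x' = x" "k' = k" by auto
    with 1 2 eval_Prec_Suc.IH show "z' = z" by blast
  qed auto
next
  case (eval_Mu p x k)
  from eval_Mu.prems have p0: "eval A p (prod_encode (x, z)) 0"
    and below: "\<forall>j<z. \<exists>y. eval A p (prod_encode (x, j)) (Suc y)"
    by (auto elim: eval_elims(9))
  show ?case
  proof (rule linorder_cases[of k z])
    assume "k < z"
    with below obtain y where "eval A p (prod_encode (x, k)) (Suc y)" by blast
    from eval_Mu.IH(1)[OF this] show ?thesis by simp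
  next
    assume "z < k"
    with eval_Mu.IH(2) obtain y where "\<And>w. eval A p (prod_encode (x, z)) w \<Longrightarrow> Suc y = w"
      by blast
    from this[OF p0] show ?thesis by simp
  qed
qed (auto elim: eval_elims(1-5))

text \<open>Goedel numbers of programs; a number that is not a code indexes the nowhere defined
  function.\<close>

primrec prog_code :: "prog \<Rightarrow> nat" where
  "prog_code Zero = prod_encode (0, 0)"
| "prog_code Succ = prod_encode (1, 0)"
| "prog_code Fst = prod_encode (2, 0)"
| "prog_code Snd = prod_encode (3, 0)"
| "prog_code Oracle = prod_encode (4, 0)"
| "prog_code (Tup p q) = prod_encode (5, prod_encode (prog_code p, prog_code q))"
| "prog_code (Comp p q) = prod_encode (6, prod_encode (prog_code p, prog_code q))"
| "prog_code (Prec p q) = prod_encode (7, prod_encode (prog_code p, prog_code q))"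
| "prog_code (Mu p) = prod_encode (8, prog_code p)"

lemma inj_prog_code: "inj prog_code"
proof (rule injI)
  show "p = q" if "prog_code p = prog_code q" for p q
    using that
  proof (induction p arbitrary: q)
    case Zero then show ?case by (cases q) auto
  next
    case Succ then show ?case by (cases q) auto
  next
    case Fst then show ?case by (cases q) auto
  next
    case Snd then show ?case by (cases q) auto
  next
    case Oracle then show ?case by (cases q) auto
  next
    case (Tup p1 p2) then show ?case by (cases q) auto
  next
    case (Comp p1 p2) then show ?case by (cases q) auto
  next
    case (Prec p1 p2) then show ?case by (cases q) auto
  next
    case (Mu p) then show ?case by (cases q) auto
  qed
qed

definition turing_jump :: "nat set \<Rightarrow> nat set" where
  "turing_jump A = {e. \<exists>p. prog_code p = e \<and> (\<exists>y. eval A p e y)}"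

definition turing_reducible :: "nat set \<Rightarrow> nat set \<Rightarrow> bool" (infix "\<le>\<^sub>T" 50) where
  "B \<le>\<^sub>T A \<longleftrightarrow> (\<exists>p. \<forall>x. eval A p x (if x \<in> B then 1 else 0))"

text \<open>Computation without an oracle is computation with the empty oracle.\<close>

definition computably_enumerable :: "nat set \<Rightarrow> bool" where
  "computably_enumerable W \<longleftrightarrow> (\<exists>p. W = {x. \<exists>y. eval {} p x y})"

text \<open>A coloring of $[\omega]^n$ is a function on all sets of naturals of which only the values
  on \<open>nsets UNIV n\<close> matter. A finite set \<open>s\<close> is coded by its canonical index
  $\sum_{i \in s} 2^i$, that is, by \<^const>\<open>set_encode\<close>.\<close>

definition ce_coloring :: "nat \<Rightarrow> (nat set \<Rightarrow> nat) \<Rightarrow> bool" where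
  "ce_coloring n C \<longleftrightarrow>
     C \<in> nsets UNIV n \<rightarrow> {0, 1} \<and>
     (\<exists>i\<in>{0, 1}. computably_enumerable (set_encode ` {s \<in> nsets UNIV n. C s = i}))"

definition almost_homogeneous :: "nat \<Rightarrow> (nat set \<Rightarrow> nat) \<Rightarrow> nat set \<Rightarrow> bool" where
  "almost_homogeneous n C A \<longleftrightarrow>
     (\<exists>F. finite F \<and> (\<exists>i. \<forall>s \<in> nsets (A - F) n. C s = i))"

definition n_cohesive :: "nat \<Rightarrow> nat set \<Rightarrow> bool" where
  "n_cohesive n A \<longleftrightarrow>
     infinite A \<and> (\<forall>C. ce_coloring n C \<longrightarrow> almost_homogeneous n C A)"

end

theory Submission
  imports Defs
begin

text \<open>
  By induction on \<open>n\<close>, simultaneously for all oracles \<open>A\<close> and sets \<open>L\<close> such that the jump of \<open>A\<close>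
  decides every relation that is enumerable from \<open>A\<close> and positive information about \<open>L\<close>.

  For \<open>n = 1\<close>, choose the next element greedily, preferring to stay in the enumerable sets of small
  index. Whether this is possible is decided by the jump of \<open>A\<close>, and as the reservoirs shrink each
  preference is given up at most once after those of smaller index have settled.

  For the step, build a sequence of reservoirs, each of them an intersection of finite unions of
  enumerable sets, which is eventually inside or disjoint from every enumerable set. Let \<open>L'\<close> be the set
  of indices of the sets avoided by it. The limit coloring of the \<open>n\<close>-element sets along the
  reservoirs only needs positive information about \<open>L'\<close>, so the induction hypothesis for the jump of
  \<open>A\<close> and \<open>L'\<close> applies and its solution can be thinned out. The crucial point is that \<open>L'\<close> is low
  in the sense above: whether \<open>L'\<close> is going to include a finite set from a given enumerable
  family \<open>\<Phi>\<close> is settled by asking whether the current reservoir meets the unions given by finitely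
  many members of \<open>\<Phi>\<close> in an infinite set. If this always holds, the members of \<open>\<Phi>\<close> can all be kept
  from being included in \<open>L'\<close>; if not, some member of \<open>\<Phi>\<close> can be put into \<open>L'\<close> at once, after
  shrinking the reservoir to a minimal counterexample. Each such question is one for the double
  jump of \<open>A\<close>.
\<close>

section \<open>Pairing of naturals\<close>

definition pr :: "nat \<Rightarrow> nat \<Rightarrow> nat" where "pr x y = prod_encode (x, y)"
definition pfst :: "nat \<Rightarrow> nat" where "pfst z = fst (prod_decode z)"
definition psnd :: "nat \<Rightarrow> nat" where "psnd z = snd (prod_decode z)"

lemma pfst_pr [simp]: "pfst (pr x y) = x" and psnd_pr [simp]: "psnd (pr x y) = y"
  by (simp_all add: pr_def pfst_def psnd_def)

lemma pr_pfst_psnd [simp]: "pr (pfst z) (psnd z) = z"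
  by (simp add: pr_def pfst_def psnd_def)

lemma pr_inject [simp]: "pr x y = pr x' y' \<longleftrightarrow> x = x' \<and> y = y'"
  by (simp add: pr_def)

subsection \<open>Total computable functions and decidable predicates\<close>

named_theorems comp_intros
named_theorems ce_intros

definition computable :: "nat set \<Rightarrow> (nat \<Rightarrow> nat) \<Rightarrow> bool" where
  "computable A f \<longleftrightarrow> (\<exists>p. \<forall>x. eval A p x (f x))"

definition decidable :: "nat set \<Rightarrow> (nat \<Rightarrow> bool) \<Rightarrow> bool" where
  "decidable A P \<longleftrightarrow> computable A (\<lambda>x. if P x then 1 else 0)"

lemma compI: "(\<And>x. eval A p x (f x)) \<Longrightarrow> computable A f"
  by (auto simp: computable_def)

lemma comp_compose: "computable A f \<Longrightarrow> computable A g \<Longrightarrow> computable A (\<lambda>x. f (g x))"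
  unfolding computable_def by (blast intro: eval_Comp)

lemma dec_compose: "decidable A P \<Longrightarrow> computable A g \<Longrightarrow> decidable A (\<lambda>x. P (g x))"
  unfolding decidable_def by (rule comp_compose)

lemma comp_pr [comp_intros]: "computable A f \<Longrightarrow> computable A g \<Longrightarrow> computable A (\<lambda>x. pr (f x) (g x))"
  unfolding computable_def pr_def by (blast intro: eval_Tup)

lemma comp_Suc [comp_intros]: "computable A f \<Longrightarrow> computable A (\<lambda>x. Suc (f x))"
  by (rule comp_compose[where f = Suc]) (auto intro: compI eval_Succ)

lemma comp_pfst [comp_intros]: "computable A f \<Longrightarrow> computable A (\<lambda>x. pfst (f x))"
  by (rule comp_compose[where f = pfst]) (auto intro!: compI eval_Fst simp: pfst_def)

lemma comp_psnd [comp_intros]: "computable A f \<Longrightarrow> computable A (\<lambda>x. psnd (f x))"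
  by (rule comp_compose[where f = psnd]) (auto intro!: compI eval_Snd simp: psnd_def)

lemma eval_id: "eval A (Tup Fst Snd) x x"
  using eval_Tup[OF eval_Fst eval_Snd, of A x] by simp

lemma comp_id [comp_intros]: "computable A (\<lambda>x. x)"
  by (rule compI) (rule eval_id)

primrec const_prog :: "nat \<Rightarrow> prog" where
  "const_prog 0 = Zero"
| "const_prog (Suc c) = Comp Succ (const_prog c)"

lemma eval_const_prog: "eval A (const_prog c) x c"
  by (induction c) (auto intro: eval_Zero eval_Comp eval_Succ)

lemma comp_const [comp_intros]: "computable A (\<lambda>x. c)"
  by (rule compI) (rule eval_const_prog)

text \<open>Stated for a curried \<open>h\<close> so that \<open>rec_nat\<close> terms match
  directly; the third hypothesis reads its arguments off the nested pair that \<open>Prec\<close>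
  passes to its step program.\<close>

lemma comp_rec [comp_intros]:
  assumes "computable A a" "computable A n" "computable A (\<lambda>z. h (pfst z) (pfst (psnd z)) (psnd (psnd z)))"
  shows "computable A (\<lambda>x. rec_nat (a x) (\<lambda>k y. h x k y) (n x))"
proof -
  obtain p where p: "\<And>x. eval A p x (a x)" using assms(1) by (auto simp: computable_def)
  obtain q where q: "\<And>z. eval A q z (h (pfst z) (pfst (psnd z)) (psnd (psnd z)))"
    using assms(3) by (auto simp: computable_def)
  have "eval A (Prec p q) (pr x k) (rec_nat (a x) (\<lambda>k y. h x k y) k)" for x k
  proof (induction k)
    case 0
    show ?case unfolding pr_def by (simp add: eval_Prec_0 p)
  next
    case (Suc k)
    show ?case
      using eval_Prec_Suc[OF Suc[unfolded pr_def], of "h x k (rec_nat (a x) (h x) k)"]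
        q[of "pr x (pr k (rec_nat (a x) (h x) k))"]
      by (simp add: pr_def[symmetric])
  qed
  then have "computable A (\<lambda>z. rec_nat (a (pfst z)) (\<lambda>k y. h (pfst z) k y) (psnd z))"
    by (intro compI[of _ "Prec p q"]) (metis pr_pfst_psnd)
  from comp_compose[OF this comp_pr[OF comp_id assms(2)]] show ?thesis by simp
qed

text \<open>A case distinction is a primitive recursion of length 0 or 1 whose step ignores the
  previous value.\<close>

lemma comp_if [comp_intros]:
  assumes "decidable A P" "computable A f" "computable A g"
  shows "computable A (\<lambda>x. if P x then f x else g x)"
proof -
  have "computable A (\<lambda>x. rec_nat (g x) (\<lambda>_ _. f x) (if P x then 1 else 0))"
    by (intro comp_intros comp_compose[OF assms(2)] assms(1)[unfolded decidable_def] assms(3))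
  also have "(\<lambda>x. rec_nat (g x) (\<lambda>_ _. f x) (if P x then 1 else 0))
    = (\<lambda>x. if P x then f x else g x)" by auto
  finally show ?thesis .
qed

lemma dec_cong: "decidable A P \<Longrightarrow> (\<And>x. P x \<longleftrightarrow> Q x) \<Longrightarrow> decidable A Q"
  by (simp add: decidable_def)

lemma comp_cong: "computable A f \<Longrightarrow> (\<And>x. f x = g x) \<Longrightarrow> computable A g"
  by (simp add: computable_def)

lemma dec_not [comp_intros]: "decidable A P \<Longrightarrow> decidable A (\<lambda>x. \<not> P x)"
  unfolding decidable_def
  by (rule comp_cong[OF comp_if[OF _ comp_const[of A 0] comp_const[of A 1]]])
    (auto simp: decidable_def)

lemma dec_conj [comp_intros]: "decidable A P \<Longrightarrow> decidable A Q \<Longrightarrow> decidable A (\<lambda>x. P x \<and> Q x)"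
proof -
  assume "decidable A P" "decidable A Q"
  then have "computable A (\<lambda>x. if P x then if Q x then 1 else 0 else 0)"
    by (intro comp_if comp_const)
  then show ?thesis unfolding decidable_def by (rule comp_cong) auto
qed

lemma dec_disj [comp_intros]: "decidable A P \<Longrightarrow> decidable A Q \<Longrightarrow> decidable A (\<lambda>x. P x \<or> Q x)"
  by (rule dec_cong[OF dec_not[OF dec_conj[OF dec_not dec_not]]]) auto

lemma dec_imp [comp_intros]: "decidable A P \<Longrightarrow> decidable A Q \<Longrightarrow> decidable A (\<lambda>x. P x \<longrightarrow> Q x)"
  by (rule dec_cong[OF dec_disj[OF dec_not]]) auto

lemma dec_iff [comp_intros]: "decidable A P \<Longrightarrow> decidable A Q \<Longrightarrow> decidable A (\<lambda>x. P x \<longleftrightarrow> Q x)"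
  by (rule dec_cong[OF dec_conj[OF dec_imp[of A P Q] dec_imp[of A Q P]]]) auto

lemma comp_add [comp_intros]: "computable A f \<Longrightarrow> computable A g \<Longrightarrow> computable A (\<lambda>x. f x + g x)"
proof -
  assume *: "computable A f" "computable A g"
  have "computable A (\<lambda>x. rec_nat (f x) (\<lambda>k y. Suc y) (g x))" by (intro comp_intros *)
  moreover have "rec_nat a (\<lambda>k y. Suc y) b = a + b" for a b :: nat by (induction b) auto
  ultimately show ?thesis by simp
qed

lemma comp_diff [comp_intros]: "computable A f \<Longrightarrow> computable A g \<Longrightarrow> computable A (\<lambda>x. f x - g x)"
proof -
  assume *: "computable A f" "computable A g"
  have "computable A (\<lambda>x. rec_nat 0 (\<lambda>k y. k) x)" by (intro comp_intros)
  moreover have "rec_nat 0 (\<lambda>k y. k) = (\<lambda>x::nat. x - 1)"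
    proof (rule ext)
      show "rec_nat 0 (\<lambda>k y. k) x = x - 1" for x :: nat by (cases x) auto
    qed
  ultimately have pred: "computable A (\<lambda>x. x - 1)" by simp
  have "computable A (\<lambda>x. rec_nat (f x) (\<lambda>k y. y - 1) (g x))"
    by (intro comp_intros * comp_compose[OF pred])
  moreover have "rec_nat a (\<lambda>k y. y - 1) b = a - b" for a b :: nat by (induction b) auto
  ultimately show ?thesis by simp
qed

lemma comp_mult [comp_intros]: "computable A f \<Longrightarrow> computable A g \<Longrightarrow> computable A (\<lambda>x. f x * g x)"
proof -
  assume *: "computable A f" "computable A g"
  have "computable A (\<lambda>x. rec_nat 0 (\<lambda>k y. y + f x) (g x))"
    by (intro comp_intros * comp_compose[OF *(1)])
  moreover have "rec_nat 0 (\<lambda>k y. y + a) b = a * b" for a b :: nat by (induction b) auto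
  ultimately show ?thesis by simp
qed

lemma comp_power2 [comp_intros]: "computable A f \<Longrightarrow> computable A (\<lambda>x. 2 ^ f x)"
proof -
  assume *: "computable A f"
  have "computable A (\<lambda>x. rec_nat 1 (\<lambda>k y. y + y) (f x))" by (intro comp_intros *)
  moreover have "rec_nat 1 (\<lambda>k y. y + y) b = (2::nat) ^ b" for b by (induction b) auto
  ultimately show ?thesis by simp
qed

lemma dec_le [comp_intros]: "computable A f \<Longrightarrow> computable A g \<Longrightarrow> decidable A (\<lambda>x. f x \<le> g x)"
proof -
  assume *: "computable A f" "computable A g"
  have "computable A (\<lambda>x. rec_nat 1 (\<lambda>k y. 0) (f x - g x))" by (intro comp_intros *)
  moreover have "rec_nat 1 (\<lambda>k y. 0) (a - b) = (if a \<le> b then 1 else (0::nat))" for a b :: nat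
    by (cases "a - b") auto
  ultimately show ?thesis by (simp only: decidable_def)
qed

lemma dec_eq [comp_intros]: "computable A f \<Longrightarrow> computable A g \<Longrightarrow> decidable A (\<lambda>x. f x = g x)"
  by (rule dec_cong[OF dec_conj[OF dec_le[of A f g] dec_le[of A g f]]]) auto

lemma dec_less [comp_intros]: "computable A f \<Longrightarrow> computable A g \<Longrightarrow> decidable A (\<lambda>x. f x < g x)"
  by (rule dec_cong[OF dec_not[OF dec_le[of A g f]]]) auto

lemma dec_all_less [comp_intros]:
  assumes "computable A n" "decidable A (\<lambda>z. P (pfst z) (psnd z))"
  shows "decidable A (\<lambda>x. \<forall>k<n x. P x k)"
proof -
  have "decidable A (\<lambda>z. P (pfst z) (pfst (psnd z)))"
    using dec_compose[OF assms(2), of "\<lambda>z. pr (pfst z) (pfst (psnd z))"]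
    by (simp add: comp_intros)
  then have "computable A (\<lambda>x. rec_nat 1 (\<lambda>k y. if P x k then y else 0) (n x))"
    by (intro comp_intros assms(1))
  moreover have "rec_nat 1 (\<lambda>k y. if P x k then y else 0) b = (if \<forall>k<b. P x k then 1 else (0::nat))"
    for x b by (induction b) (auto simp: less_Suc_eq)
  ultimately show ?thesis by (simp add: decidable_def)
qed

lemma dec_ex_less [comp_intros]:
  assumes "computable A n" "decidable A (\<lambda>z. P (pfst z) (psnd z))"
  shows "decidable A (\<lambda>x. \<exists>k<n x. P x k)"
  by (rule dec_cong[OF dec_not[OF dec_all_less[OF assms(1) dec_not[OF assms(2)]]]]) auto

section \<open>Canonical indices of finite sets\<close>

lemma set_decode_power2 [simp]: "set_decode (2 ^ k) = {k}"
  using set_encode_inverse[of "{k}"] by (simp add: set_encode_def)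

lemma mem_set_decode_less: "k \<in> set_decode n \<Longrightarrow> k < n"
proof -
  assume k: "k \<in> set_decode n"
  have "k < 2 ^ k" by (rule less_exp)
  also have "2 ^ k = set_encode {k}" by simp
  also have "\<dots> \<le> set_encode (set_decode n)"
    unfolding set_encode_def using k by (intro sum_mono2) auto
  finally show ?thesis by simp
qed

text \<open>Bounded quantifiers over sums, products and powers of two describe a binary digit, so
  that the closure rules yield its decidability.\<close>

lemma mem_set_decode_iff:
  "k \<in> set_decode n \<longleftrightarrow> (\<exists>q<Suc n. \<exists>r<2 ^ k. n = (2 * q + 1) * 2 ^ k + r)"
proof
  assume "k \<in> set_decode n"
  then have "odd (n div 2 ^ k)" by (simp add: set_decode_def)
  then have q: "n div 2 ^ k = 2 * (n div 2 ^ k div 2) + 1" by (simp add: odd_two_times_div_two_succ)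
  have "n = (2 * (n div 2 ^ k div 2) + 1) * 2 ^ k + n mod 2 ^ k"
    unfolding q[symmetric] by (rule div_mult_mod_eq[symmetric])
  moreover have "n div 2 ^ k div 2 < Suc n"
    by (meson div_le_dividend le_imp_less_Suc le_trans)
  moreover have "n mod 2 ^ k < 2 ^ k" by simp
  ultimately show "\<exists>q<Suc n. \<exists>r<2 ^ k. n = (2 * q + 1) * 2 ^ k + r" by blast
next
  assume "\<exists>q<Suc n. \<exists>r<2 ^ k. n = (2 * q + 1) * 2 ^ k + r"
  then obtain q r where "r < 2 ^ k" "n = (2 * q + 1) * 2 ^ k + r" by auto
  then have "n div 2 ^ k = 2 * q + 1" by (simp add: div_nat_eqI)
  then show "k \<in> set_decode n" by (simp add: set_decode_def)
qed

lemma dec_mem_set_decode [comp_intros]: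
  assumes "computable A f" "computable A g"
  shows "decidable A (\<lambda>x. f x \<in> set_decode (g x))"
  unfolding mem_set_decode_iff
  by (intro comp_intros comp_compose[OF assms(1)] comp_compose[OF assms(2)])

lemma dec_ball_set_decode [comp_intros]:
  assumes "computable A n" "decidable A (\<lambda>z. P (pfst z) (psnd z))"
  shows "decidable A (\<lambda>x. \<forall>k\<in>set_decode (n x). P x k)"
proof -
  have "decidable A (\<lambda>x. \<forall>k<n x. k \<in> set_decode (n x) \<longrightarrow> P x k)"
    by (intro comp_intros assms comp_compose[OF assms(1)])
  then show ?thesis by (rule dec_cong) (auto dest: mem_set_decode_less)
qed

lemma dec_subset_set_decode [comp_intros]:
  assumes "computable A f" "computable A g"
  shows "decidable A (\<lambda>x. set_decode (f x) \<subseteq> set_decode (g x))"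
  unfolding subset_iff Ball_def[symmetric]
  by (intro comp_intros assms comp_compose[OF assms(2)])

lemma comp_set_encode:
  assumes "computable A n" "decidable A (\<lambda>z. P (pfst z) (psnd z))"
  shows "computable A (\<lambda>x. set_encode {u. u < n x \<and> P x u})"
proof -
  have "decidable A (\<lambda>z. P (pfst z) (pfst (psnd z)))"
    using dec_compose[OF assms(2), of "\<lambda>z. pr (pfst z) (pfst (psnd z))"]
    by (simp add: comp_intros)
  then have "computable A (\<lambda>x. rec_nat 0 (\<lambda>k y. if P x k then y + 2 ^ k else y) (n x))"
    by (intro comp_intros assms(1))
  moreover have "rec_nat 0 (\<lambda>k y. if P x k then y + 2 ^ k else y) b = set_encode {u. u < b \<and> P x u}"
    for x b
  proof (induction b)
    case (Suc b)
    have "{u. u < Suc b \<and> P x u} = (if P x b then insert b {u. u < b \<and> P x u} else {u. u < b \<and> P x u})"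
      by (auto simp: less_Suc_eq)
    with Suc show ?case by (simp add: set_encode_insert)
  qed simp
  ultimately show ?thesis by simp
qed

subsection \<open>Enumerability relative to positive information\<close>

text \<open>\<open>P\<close> is computably enumerable with full access to \<open>A\<close>, but using only the information that
  certain numbers belong to \<open>L\<close>. For \<open>L = {}\<close> this is enumerability in \<open>A\<close>.\<close>

definition ce :: "nat set \<Rightarrow> nat set \<Rightarrow> (nat \<Rightarrow> bool) \<Rightarrow> bool" where
  "ce A L P \<longleftrightarrow> (\<exists>R. decidable A R \<and>
     (\<forall>x. P x \<longleftrightarrow> (\<exists>y N. set_decode N \<subseteq> L \<and> R (pr x (pr y N)))))"

lemma ceI:
  assumes "decidable A (\<lambda>z. R (pfst z) (pfst (psnd z)) (psnd (psnd z)))"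
    and "\<And>x. P x \<longleftrightarrow> (\<exists>y N. set_decode N \<subseteq> L \<and> R x y N)"
  shows "ce A L P"
  unfolding ce_def using assms by (intro exI[of _ "\<lambda>z. R (pfst z) (pfst (psnd z)) (psnd (psnd z))"]) simp

lemma ceE:
  assumes "ce A L P"
  obtains R where "decidable A (\<lambda>z. R (pfst z) (pfst (psnd z)) (psnd (psnd z)))"
    "\<And>x. P x \<longleftrightarrow> (\<exists>y N. set_decode N \<subseteq> L \<and> R x y N)"
proof -
  obtain R where R: "decidable A R" "\<And>x. P x \<longleftrightarrow> (\<exists>y N. set_decode N \<subseteq> L \<and> R (pr x (pr y N)))"
    using assms unfolding ce_def by blast
  show thesis
    by (rule that[of "\<lambda>x y N. R (pr x (pr y N))"]) (simp_all add: R)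
qed

lemma ce_cong: "ce A L P \<Longrightarrow> (\<And>x. P x \<longleftrightarrow> Q x) \<Longrightarrow> ce A L Q"
  by (simp add: ce_def)

lemma ce_dec:
  assumes P: "decidable A P"
  shows "ce A L P"
proof (rule ceI[where R = "\<lambda>x y N. P x"])
  show "P x \<longleftrightarrow> (\<exists>y N. set_decode N \<subseteq> L \<and> P x)" for x
    by (metis empty_subsetI set_decode_zero)
qed (intro dec_compose[OF P] comp_intros)

lemma ce_mono: "ce A {} P \<Longrightarrow> ce A L P"
proof (erule ceE)
  fix R
  assume R: "decidable A (\<lambda>z. R (pfst z) (pfst (psnd z)) (psnd (psnd z)))"
    and P: "\<And>x. P x \<longleftrightarrow> (\<exists>y N. set_decode N \<subseteq> {} \<and> R x y N)"
  \<comment> \<open>Over the empty set only \<open>N = 0\<close> counts. Fixing this value inside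
    the relation keeps codes of nonempty subsets of \<open>L\<close> from acting as new
    certificates.\<close>
  have "decidable A (\<lambda>z. R (pfst z) (pfst (psnd z)) 0)"
    using dec_compose[OF R, of "\<lambda>z. pr (pfst z) (pr (pfst (psnd z)) 0)"] by (simp add: comp_intros)
  then show "ce A L P"
  proof (rule ceI)
    have "N = 0" if "set_decode N \<subseteq> {}" for N
      using that by (metis set_decode_inverse set_encode_empty subset_empty)
    then show "P x \<longleftrightarrow> (\<exists>y N. set_decode N \<subseteq> L \<and> R x y 0)" for x
      unfolding P by (metis empty_subsetI set_decode_zero)
  qed
qed

lemma ce_compose: "ce A L P \<Longrightarrow> computable A g \<Longrightarrow> ce A L (\<lambda>x. P (g x))"
proof (erule ceE)
  fix R
  assume g: "computable A g" and R: "decidable A (\<lambda>z. R (pfst z) (pfst (psnd z)) (psnd (psnd z)))"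
    and P: "\<And>x. P x \<longleftrightarrow> (\<exists>y N. set_decode N \<subseteq> L \<and> R x y N)"
  have "decidable A (\<lambda>z. R (g (pfst z)) (pfst (psnd z)) (psnd (psnd z)))"
    using dec_compose[OF R, of "\<lambda>z. pr (g (pfst z)) (psnd z)"]
    by (simp add: comp_intros comp_compose[OF g])
  then show "ce A L (\<lambda>x. P (g x))"
    by (intro ceI[where R = "\<lambda>x. R (g x)"]) (auto simp: P)
qed

lemma ce_disj [ce_intros]: "ce A L P \<Longrightarrow> ce A L Q \<Longrightarrow> ce A L (\<lambda>x. P x \<or> Q x)"
proof (elim ceE)
  fix R R'
  assume R: "decidable A (\<lambda>z. R (pfst z) (pfst (psnd z)) (psnd (psnd z)))"
      "decidable A (\<lambda>z. R' (pfst z) (pfst (psnd z)) (psnd (psnd z)))"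
    and P: "\<And>x. P x \<longleftrightarrow> (\<exists>y N. set_decode N \<subseteq> L \<and> R x y N)"
      "\<And>x. Q x \<longleftrightarrow> (\<exists>y N. set_decode N \<subseteq> L \<and> R' x y N)"
  show "ce A L (\<lambda>x. P x \<or> Q x)"
    by (rule ceI[where R = "\<lambda>x y N. R x y N \<or> R' x y N"]) (auto simp: P intro: R comp_intros)
qed

lemma ce_ex [ce_intros]: "ce A L (\<lambda>z. P (pfst z) (psnd z)) \<Longrightarrow> ce A L (\<lambda>x. \<exists>y. P x y)"
proof (erule ceE)
  fix R
  assume R: "decidable A (\<lambda>z. R (pfst z) (pfst (psnd z)) (psnd (psnd z)))"
    and P: "\<And>x. P (pfst x) (psnd x) \<longleftrightarrow> (\<exists>y N. set_decode N \<subseteq> L \<and> R x y N)"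
  have P': "P x y \<longleftrightarrow> (\<exists>v N. set_decode N \<subseteq> L \<and> R (pr x y) v N)" for x y
    using P[of "pr x y"] by simp
  have "decidable A (\<lambda>z. R (pr (pfst z) (pfst (pfst (psnd z)))) (psnd (pfst (psnd z))) (psnd (psnd z)))"
    using dec_compose[OF R, of "\<lambda>z. pr (pr (pfst z) (pfst (pfst (psnd z)))) (pr (psnd (pfst (psnd z))) (psnd (psnd z)))"]
    by (simp add: comp_intros)
  then show "ce A L (\<lambda>x. \<exists>y. P x y)"
    by (rule ceI[where R = "\<lambda>x y N. R (pr x (pfst y)) (psnd y) N"]) (metis P' pfst_pr psnd_pr)
qed

text \<open>The certificates for the finitely many \<open>k\<close> are merged: \<open>y\<close>
  bounds all witnesses and \<open>N\<close> codes the union of the finite sets used.\<close>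

lemma ce_all_less [ce_intros]:
  assumes n: "computable A n" and "ce A L (\<lambda>z. P (pfst z) (psnd z))"
  shows "ce A L (\<lambda>x. \<forall>k<n x. P x k)"
  using assms(2)
proof (rule ceE)
  fix R
  assume R: "decidable A (\<lambda>z. R (pfst z) (pfst (psnd z)) (psnd (psnd z)))"
    and P: "\<And>x. P (pfst x) (psnd x) \<longleftrightarrow> (\<exists>y N. set_decode N \<subseteq> L \<and> R x y N)"
  have P': "P x y \<longleftrightarrow> (\<exists>v N. set_decode N \<subseteq> L \<and> R (pr x y) v N)" for x y
    using P[of "pr x y"] by simp
  have R': "decidable A (\<lambda>z. R (a z) (b z) (c z))"
    if "computable A a" "computable A b" "computable A c" for a b c
    using dec_compose[OF R, of "\<lambda>z. pr (a z) (pr (b z) (c z))"] by (simp add: comp_intros that)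
  show "ce A L (\<lambda>x. \<forall>k<n x. P x k)"
  proof (rule ceI[where R = "\<lambda>x y N. \<forall>k<n x. \<exists>v<y. \<exists>M<y. set_decode M \<subseteq> set_decode N \<and> R (pr x k) v M"])
    show "decidable A (\<lambda>z. \<forall>k<n (pfst z). \<exists>v<pfst (psnd z). \<exists>M<pfst (psnd z).
        set_decode M \<subseteq> set_decode (psnd (psnd z)) \<and> R (pr (pfst z) k) v M)"
      by (intro comp_intros comp_compose[OF n] R')
  next
    fix x
    show "(\<forall>k<n x. P x k) \<longleftrightarrow> (\<exists>y N. set_decode N \<subseteq> L \<and>
       (\<forall>k<n x. \<exists>v<y. \<exists>M<y. set_decode M \<subseteq> set_decode N \<and> R (pr x k) v M))" (is "?l \<longleftrightarrow> ?r")
    proof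
      assume ?l
      then have "\<forall>k. \<exists>v N. k < n x \<longrightarrow> set_decode N \<subseteq> L \<and> R (pr x k) v N"
        unfolding P' by blast
      then obtain v N where vN: "\<And>k. k < n x \<Longrightarrow> set_decode (N k) \<subseteq> L \<and> R (pr x k) (v k) (N k)"
        by metis
      define U where "U = (\<Union>k<n x. set_decode (N k))"
      define y where "y = Suc (\<Sum>k<n x. v k + N k)"
      have "finite U" by (simp add: U_def)
      have "v k < y \<and> N k < y" if "k < n x" for k
      proof -
        have "v k + N k \<le> (\<Sum>k<n x. v k + N k)" using that by (intro member_le_sum) auto
        then show ?thesis by (simp add: y_def)
      qed
      with vN \<open>finite U\<close> have "\<forall>k<n x. \<exists>v<y. \<exists>M<y. set_decode M \<subseteq> set_decode (set_encode U) \<and> R (pr x k) v M"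
        by (metis U_def UN_upper lessThan_iff set_encode_inverse)
      moreover have "set_decode (set_encode U) \<subseteq> L" using vN \<open>finite U\<close> by (auto simp: U_def)
      ultimately show ?r by blast
    next
      assume ?r then show ?l unfolding P' by (meson subset_trans)
    qed
  qed
qed

lemma ce_conj [ce_intros]: "ce A L P \<Longrightarrow> ce A L Q \<Longrightarrow> ce A L (\<lambda>x. P x \<and> Q x)"
proof -
  assume *: "ce A L P" "ce A L Q"
  have "ce A L (\<lambda>x. \<forall>k<2. k = (0::nat) \<and> P x \<or> k \<noteq> 0 \<and> Q x)"
  proof (rule ce_all_less)
    have dec: "ce A L (\<lambda>z. d z \<and> p z)" if d: "decidable A d" and p: "ce A L p" for d p
      using p
    proof (rule ceE)
      fix R
      assume R: "decidable A (\<lambda>z. R (pfst z) (pfst (psnd z)) (psnd (psnd z)))"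
        and p: "\<And>x. p x \<longleftrightarrow> (\<exists>y N. set_decode N \<subseteq> L \<and> R x y N)"
      show ?thesis
        by (rule ceI[where R = "\<lambda>x y N. d x \<and> R x y N"], intro R comp_intros dec_compose[OF d])
          (auto simp: p)
    qed
    show "ce A L (\<lambda>z. psnd z = 0 \<and> P (pfst z) \<or> psnd z \<noteq> 0 \<and> Q (pfst z))"
      by (intro ce_disj dec comp_intros ce_compose[OF *(1)] ce_compose[OF *(2)])
  qed (rule comp_const)
  then show ?thesis by (rule ce_cong) (auto simp: less_2_cases_iff)
qed

lemma ce_ball_set_decode [ce_intros]:
  assumes n: "computable A n" and P: "ce A L (\<lambda>z. P (pfst z) (psnd z))"
  shows "ce A L (\<lambda>x. \<forall>k\<in>set_decode (n x). P x k)"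
proof -
  have "ce A L (\<lambda>x. \<forall>k<n x. k \<notin> set_decode (n x) \<or> P x k)"
    by (intro ce_all_less n ce_disj P ce_dec comp_intros comp_compose[OF n])
  then show ?thesis by (rule ce_cong) (auto dest: mem_set_decode_less)
qed

lemma ce_bex_set_decode [ce_intros]:
  assumes n: "computable A n" and P: "ce A L (\<lambda>z. P (pfst z) (psnd z))"
  shows "ce A L (\<lambda>x. \<exists>k\<in>set_decode (n x). P x k)"
proof -
  have "ce A L (\<lambda>x. \<exists>k. k \<in> set_decode (n x) \<and> P x k)"
    by (intro ce_ex ce_conj P ce_dec comp_intros comp_compose[OF n])
  then show ?thesis by (rule ce_cong) auto
qed

lemma ce_subset [ce_intros]:
  assumes f: "computable A f"
  shows "ce A L (\<lambda>x. set_decode (f x) \<subseteq> L)"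
proof (rule ceI[where R = "\<lambda>x y N. set_decode (f x) \<subseteq> set_decode N"])
  show "decidable A (\<lambda>z. set_decode (f (pfst z)) \<subseteq> set_decode (psnd (psnd z)))"
    by (intro comp_intros comp_compose[OF f])
qed auto

lemma ce_mem [ce_intros]: "computable A f \<Longrightarrow> ce A L (\<lambda>x. f x \<in> L)"
proof -
  assume f: "computable A f"
  have "ce A L (\<lambda>x. set_decode (2 ^ f x) \<subseteq> L)" by (intro ce_intros comp_intros f)
  then show ?thesis by simp
qed

subsection \<open>Unbounded search\<close>

text \<open>\<open>Mu\<close> looks for the value 0, so it is applied to a program for the negation
  of \<open>R\<close>. That program is total, hence the search cannot get stuck before the first
  solution.\<close>

lemma mu_prog:
  assumes "decidable A R"
  shows "\<exists>p. \<forall>x. (\<forall>k. eval A p x k \<longrightarrow> R (pr x k)) \<and> ((\<exists>k. R (pr x k)) \<longrightarrow> (\<exists>k. eval A p x k))"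
proof -
  have "decidable A (\<lambda>z. \<not> R z)" by (intro comp_intros assms)
  then obtain p where p: "\<And>z. eval A p z (if \<not> R z then 1 else 0)"
    unfolding decidable_def computable_def by blast
  have iff: "eval A p z y \<longleftrightarrow> y = (if \<not> R z then 1 else 0)" for z y
  proof
    show "eval A p z y \<Longrightarrow> y = (if \<not> R z then 1 else 0)"
      using eval_deterministic[OF _ p[of z]] by simp
    show "y = (if \<not> R z then 1 else 0) \<Longrightarrow> eval A p z y"
      using p[of z] by simp
  qed
  have Mu: "eval A (Mu p) x k \<longleftrightarrow> R (pr x k) \<and> (\<forall>j<k. \<not> R (pr x j))" for x k
  proof -
    have "eval A (Mu p) x k \<longleftrightarrow> eval A p (pr x k) 0 \<and> (\<forall>j<k. \<exists>y. eval A p (pr x j) (Suc y))"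
      unfolding pr_def by (auto elim: eval_elims(9) intro: eval_Mu)
    then show ?thesis unfolding iff by auto
  qed
  have "eval A (Mu p) x (LEAST k. R (pr x k))" if "\<exists>k. R (pr x k)" for x
    unfolding Mu using LeastI_ex[OF that] not_less_Least[of _ "\<lambda>k. R (pr x k)"] by blast
  moreover have "R (pr x k)" if "eval A (Mu p) x k" for x k using that unfolding Mu ..
  ultimately show ?thesis by (intro exI[of _ "Mu p"]) blast
qed

lemma ce_emptyE:
  assumes "ce A {} P"
  obtains R where "decidable A R" "\<And>x. P x \<longleftrightarrow> (\<exists>y. R (pr x y))"
  using assms
proof (rule ceE)
  fix R
  assume R: "decidable A (\<lambda>z. R (pfst z) (pfst (psnd z)) (psnd (psnd z)))"
    and P: "\<And>x. P x \<longleftrightarrow> (\<exists>y N. set_decode N \<subseteq> {} \<and> R x y N)"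
  have "decidable A (\<lambda>z. R (pfst z) (psnd z) 0)"
    using dec_compose[OF R, of "\<lambda>z. pr (pfst z) (pr (psnd z) 0)"] by (simp add: comp_intros)
  moreover have "N = 0" if "set_decode N \<subseteq> {}" for N
    using that by (metis set_decode_inverse set_encode_empty subset_empty)
  then have "P x \<longleftrightarrow> (\<exists>y. R x y 0)" for x unfolding P by (metis empty_subsetI set_decode_zero)
  ultimately show thesis using that[of "\<lambda>z. R (pfst z) (psnd z) 0"] by simp
qed

lemma ce_empty_prog:
  assumes "ce A {} P"
  shows "\<exists>p. \<forall>x. P x \<longleftrightarrow> (\<exists>y. eval A p x y)"
proof -
  obtain R where R: "decidable A R" and P: "\<And>x. P x \<longleftrightarrow> (\<exists>y. R (pr x y))"
    using ce_emptyE[OF assms] by blast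
  obtain p where p: "\<forall>x. (\<forall>k. eval A p x k \<longrightarrow> R (pr x k)) \<and> ((\<exists>k. R (pr x k)) \<longrightarrow> (\<exists>k. eval A p x k))"
    using mu_prog[OF R] ..
  have "P x \<longleftrightarrow> (\<exists>y. eval A p x y)" for x
    unfolding P[of x] using p[rule_format, of x] by blast
  then show ?thesis by blast
qed

lemma ce_choice:
  assumes "ce A {} P" and ex: "\<And>x. \<exists>y. P (pr x y)"
  shows "\<exists>f. computable A f \<and> (\<forall>x. P (pr x (f x)))"
proof -
  obtain R where R: "decidable A R" and P: "\<And>x. P x \<longleftrightarrow> (\<exists>y. R (pr x y))"
    using ce_emptyE[OF assms(1)] by blast
  \<comment> \<open>The search runs over pairs of a value and its certificate; the value is
    projected out of the pair found.\<close>
  define R' where "R' z \<longleftrightarrow> R (pr (pr (pfst z) (pfst (psnd z))) (psnd (psnd z)))" for z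
  have "decidable A R'" unfolding R'_def by (intro dec_compose[OF R] comp_intros)
  then obtain p where p: "\<forall>x. (\<forall>k. eval A p x k \<longrightarrow> R' (pr x k)) \<and>
      ((\<exists>k. R' (pr x k)) \<longrightarrow> (\<exists>k. eval A p x k))"
    using mu_prog[of A R'] by blast
  have "\<exists>k. eval A p x k" for x
  proof -
    obtain y where "P (pr x y)" using ex ..
    then obtain k where "R (pr (pr x y) k)" unfolding P ..
    then have "R' (pr x (pr y k))" by (simp add: R'_def)
    then show ?thesis using p by blast
  qed
  then obtain k where k: "\<And>x. eval A p x (k x)" by metis
  have "P (pr x (pfst (k x)))" for x
  proof -
    have "R' (pr x (k x))" using p k[of x] by blast
    then show ?thesis unfolding P R'_def by auto
  qed
  moreover have "computable A (\<lambda>x. pfst (k x))" by (intro comp_intros compI[OF k])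
  ultimately show ?thesis by (intro exI[of _ "\<lambda>x. pfst (k x)"]) simp
qed

text \<open>\<open>ce_choice\<close> makes the next state a computable function of stage and state,
  and primitive recursion iterates it.\<close>

lemma ce_iterate:
  assumes P: "ce A {} P" and ex: "\<And>k u. \<exists>v. P (pr k (pr u v))"
  shows "\<exists>f. computable A f \<and> f 0 = u0 \<and> (\<forall>k. P (pr k (pr (f k) (f (Suc k)))))"
proof -
  have "ce A {} (\<lambda>z. P (pr (pfst (pfst z)) (pr (psnd (pfst z)) (psnd z))))"
    by (intro ce_compose[OF P] comp_intros)
  then have "\<exists>g. computable A g \<and> (\<forall>x. P (pr (pfst x) (pr (psnd x) (g x))))"
    using ce_choice[of A "\<lambda>z. P (pr (pfst (pfst z)) (pr (psnd (pfst z)) (psnd z)))"] ex by simp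
  then obtain g where g: "computable A g" "\<And>x. P (pr (pfst x) (pr (psnd x) (g x)))" by blast
  define f where "f k = rec_nat u0 (\<lambda>k u. g (pr k u)) k" for k
  have "P (pr k (pr (f k) (f (Suc k))))" for k using g(2)[of "pr k (f k)"] by (simp add: f_def)
  moreover have "computable A f" unfolding f_def by (intro comp_intros comp_compose[OF g(1)])
  ultimately show ?thesis by (intro exI[of _ f]) (simp add: f_def)
qed

subsection \<open>A universal enumeration\<close>

definition fact_in :: "nat \<Rightarrow> nat \<Rightarrow> nat \<Rightarrow> nat \<Rightarrow> bool" where
  "fact_in F e x y \<longleftrightarrow> pr e (pr x y) \<in> set_decode F"

text \<open>The clauses of \<^const>\<open>eval\<close>, with all premises taken from the finite set coded by \<open>F\<close> and
  all intermediate values below \<open>t\<close>.\<close>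

definition justified :: "nat set \<Rightarrow> nat \<Rightarrow> nat \<Rightarrow> nat \<Rightarrow> nat \<Rightarrow> nat \<Rightarrow> bool" where
  "justified A t F e x y \<longleftrightarrow>
     e = pr 0 0 \<and> y = 0 \<or>
     e = pr 1 0 \<and> y = Suc x \<or>
     e = pr 2 0 \<and> y = pfst x \<or>
     e = pr 3 0 \<and> y = psnd x \<or>
     e = pr 4 0 \<and> y = (if x \<in> A then 1 else 0) \<or>
     pfst e = 5 \<and> (\<exists>a<t. \<exists>b<t. fact_in F (pfst (psnd e)) x a \<and> fact_in F (psnd (psnd e)) x b
       \<and> y = pr a b) \<or>
     pfst e = 6 \<and> (\<exists>a<t. fact_in F (psnd (psnd e)) x a \<and> fact_in F (pfst (psnd e)) a y) \<or>
     pfst e = 7 \<and> psnd x = 0 \<and> fact_in F (pfst (psnd e)) (pfst x) y \<or>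
     pfst e = 7 \<and> (\<exists>k<t. \<exists>a<t. psnd x = Suc k \<and> fact_in F e (pr (pfst x) k) a
       \<and> fact_in F (psnd (psnd e)) (pr (pfst x) (pr k a)) y) \<or>
     pfst e = 8 \<and> fact_in F (psnd e) (pr x y) 0 \<and>
       (\<forall>j<y. \<exists>a<t. fact_in F (psnd e) (pr x j) (Suc a))"

text \<open>Bounding the facts and all intermediate values by \<open>t\<close> keeps each stage
  finite and computable from \<open>A\<close>.\<close>

definition stage :: "nat set \<Rightarrow> nat \<Rightarrow> nat" where
  "stage A t = rec_nat 0 (\<lambda>t F. set_encode
     {u. u < t \<and> justified A t F (pfst u) (pfst (psnd u)) (psnd (psnd u))}) t"

lemma dec_oracle [comp_intros]:
  assumes "computable A f"
  shows "decidable A (\<lambda>x. f x \<in> A)"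
proof -
  have "decidable A (\<lambda>x. x \<in> A)"
    unfolding decidable_def by (rule compI) (rule eval_Oracle)
  from dec_compose[OF this assms] show ?thesis .
qed

lemma dec_fact_in [comp_intros]:
  "computable A a \<Longrightarrow> computable A b \<Longrightarrow> computable A c \<Longrightarrow> computable A d \<Longrightarrow>
    decidable A (\<lambda>x. fact_in (a x) (b x) (c x) (d x))"
  unfolding fact_in_def by (intro comp_intros)

lemma comp_stage [comp_intros]: "computable A f \<Longrightarrow> computable A (\<lambda>x. stage A (f x))"
proof (rule comp_compose[where f = "stage A"])
  show "computable A (stage A)"
    unfolding stage_def justified_def by (intro comp_intros comp_set_encode)
qed

lemma fact_in_stage_0: "\<not> fact_in (stage A 0) e x y"
  by (simp add: fact_in_def stage_def)

lemma fact_in_stage_Suc: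
  "fact_in (stage A (Suc t)) e x y \<longleftrightarrow> pr e (pr x y) < t \<and> justified A t (stage A t) e x y"
  by (simp add: fact_in_def stage_def)

lemma prog_code_pr:
  "prog_code Zero = pr 0 0" "prog_code Succ = pr 1 0" "prog_code Fst = pr 2 0"
  "prog_code Snd = pr 3 0" "prog_code Oracle = pr 4 0"
  "prog_code (Tup p q) = pr 5 (pr (prog_code p) (prog_code q))"
  "prog_code (Comp p q) = pr 6 (pr (prog_code p) (prog_code q))"
  "prog_code (Prec p q) = pr 7 (pr (prog_code p) (prog_code q))"
  "prog_code (Mu p) = pr 8 (prog_code p)"
  by (simp_all add: pr_def)

lemma eval_pfst: "eval A Fst x (pfst x)"
  and eval_psnd: "eval A Snd x (psnd x)"
  and eval_pr: "eval A p x y \<Longrightarrow> eval A q x z \<Longrightarrow> eval A (Tup p q) x (pr y z)"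
  unfolding pfst_def psnd_def pr_def by (auto intro: eval.intros)

lemma stage_sound: "fact_in (stage A t) (prog_code p) x y \<Longrightarrow> eval A p x y"
proof (induction t arbitrary: p x y)
  case 0
  then show ?case by (simp add: fact_in_stage_0)
next
  case (Suc t)
  then have j: "justified A t (stage A t) (prog_code p) x y" by (simp add: fact_in_stage_Suc)
  show ?case
  proof (cases p)
    case Zero
    with j show ?thesis by (simp add: justified_def prog_code_pr del: prog_code.simps) (auto intro: eval.intros)
  next
    case Succ
    with j show ?thesis by (simp add: justified_def prog_code_pr del: prog_code.simps) (auto intro: eval.intros)
  next
    case Fst
    with j show ?thesis by (simp add: justified_def prog_code_pr del: prog_code.simps) (auto intro: eval_pfst)
  next
    case Snd
    with j show ?thesis by (simp add: justified_def prog_code_pr del: prog_code.simps) (auto intro: eval_psnd)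
  next
    case Oracle
    with j show ?thesis
      using eval_Oracle[of A x] by (simp add: justified_def prog_code_pr del: prog_code.simps)
  next
    case (Tup q r)
    with j Suc.IH show ?thesis
      by (auto simp: justified_def prog_code_pr simp del: prog_code.simps intro: eval_pr)
  next
    case (Comp q r)
    with j Suc.IH show ?thesis
      by (auto simp: justified_def prog_code_pr simp del: prog_code.simps intro: eval_Comp)
  next
    case (Prec q r)
    with j consider (0) "psnd x = 0" "fact_in (stage A t) (prog_code q) (pfst x) y"
      | (Suc) k a where "psnd x = Suc k" "fact_in (stage A t) (prog_code p) (pr (pfst x) k) a"
        "fact_in (stage A t) (prog_code r) (pr (pfst x) (pr k a)) y"
      by (auto simp: justified_def prog_code_pr simp del: prog_code.simps)
    then show ?thesis
    proof cases
      case 0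
      have "eval A p (pr (pfst x) 0) y"
        unfolding pr_def Prec by (intro eval_Prec_0 Suc.IH 0)
      with 0 show ?thesis by (metis pr_pfst_psnd)
    next
      case (Suc k a)
      have "eval A p (pr (pfst x) (Suc k)) y"
        using Suc.IH[OF Suc(2)] Suc.IH[OF Suc(3)] unfolding pr_def Prec by (rule eval_Prec_Suc)
      with Suc show ?thesis by (metis pr_pfst_psnd)
    qed
  next
    case (Mu q)
    with j have 1: "fact_in (stage A t) (prog_code q) (pr x y) 0"
      and 2: "\<forall>j<y. \<exists>a. fact_in (stage A t) (prog_code q) (pr x j) (Suc a)"
      by (auto simp: justified_def prog_code_pr simp del: prog_code.simps)
    show ?thesis unfolding Mu
      using Suc.IH[OF 1] 2 Suc.IH unfolding pr_def by (blast intro: eval_Mu)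
  qed
qed

text \<open>Facts need not persist from one stage to the next by construction, so completeness is stated
  for all sufficiently late stages.\<close>

lemma stage_complete: "eval A p x y \<Longrightarrow> eventually (\<lambda>t. fact_in (stage A t) (prog_code p) x y) sequentially"
proof -
  \<comment> \<open>Being justified at all late stages suffices, as the size bound on facts is
    eventually met too.\<close>
  have shift: "eventually (\<lambda>t. fact_in (stage A t) e x y) sequentially"
    if "eventually (\<lambda>t. justified A t (stage A t) e x y) sequentially" for e x y
  proof -
    have "eventually (\<lambda>t. fact_in (stage A (Suc t)) e x y) sequentially"
      unfolding fact_in_stage_Suc
      by (intro eventually_conj that eventually_gt_at_top)
    then show ?thesis
      using eventually_sequentially_Suc[of "\<lambda>t. fact_in (stage A t) e x y"] by simp
  qed
  show "eval A p x y \<Longrightarrow> eventually (\<lambda>t. fact_in (stage A t) (prog_code p) x y) sequentially"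
  proof (induction rule: eval.induct)
    case (eval_Tup p x y q z)
    from eval_Tup.IH eventually_gt_at_top[of y] eventually_gt_at_top[of z] show ?case
      by (intro shift, eventually_elim) (auto simp: justified_def prog_code_pr pr_def[of y z, symmetric] simp del: prog_code.simps)
  next
    case (eval_Comp q x y p z)
    from eval_Comp.IH eventually_gt_at_top[of y] show ?case
      by (intro shift, eventually_elim) (auto simp: justified_def prog_code_pr simp del: prog_code.simps)
  next
    case (eval_Prec_0 p x y q)
    from eval_Prec_0.IH show ?case
      unfolding pr_def[symmetric]
      by (intro shift, eventually_elim) (auto simp: justified_def prog_code_pr simp del: prog_code.simps)
  next
    case (eval_Prec_Suc p q x k y z)
    from eval_Prec_Suc.IH eventually_gt_at_top[of k] eventually_gt_at_top[of y] show ?case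
      unfolding pr_def[symmetric]
      by (intro shift, eventually_elim) (auto simp: justified_def prog_code_pr simp del: prog_code.simps)
  next
    case (eval_Mu p x k)
    \<comment> \<open>Each of the finitely many \<open>j < k\<close> has its own value and its own
      stage; late stages serve all of them.\<close>
    have "eventually (\<lambda>t. \<exists>a<t. fact_in (stage A t) (prog_code p) (pr x j) (Suc a)) sequentially"
      if j: "j \<in> {..<k}" for j
    proof -
      from eval_Mu.IH(2) j obtain a where
        "eventually (\<lambda>t. fact_in (stage A t) (prog_code p) (pr x j) (Suc a)) sequentially"
        unfolding pr_def by blast
      with eventually_gt_at_top[of a] show ?thesis by eventually_elim auto
    qed
    then have "eventually (\<lambda>t. \<forall>j\<in>{..<k}. \<exists>a<t. fact_in (stage A t) (prog_code p) (pr x j) (Suc a)) sequentially"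
      by (simp add: eventually_ball_finite)
    with eval_Mu.IH(1) show ?case
      unfolding pr_def[symmetric]
      by (intro shift, eventually_elim) (auto simp: justified_def prog_code_pr simp del: prog_code.simps)
  qed (intro shift always_eventually allI,
       simp add: justified_def prog_code_pr pfst_def[symmetric] psnd_def[symmetric] del: prog_code.simps)+
qed

definition univ :: "nat set \<Rightarrow> nat \<Rightarrow> nat \<Rightarrow> bool" where
  "univ A e x \<longleftrightarrow> (\<exists>t y. fact_in (stage A t) e x y)"

lemma univ_prog_code: "univ A (prog_code p) x \<longleftrightarrow> (\<exists>y. eval A p x y)"
proof
  show "univ A (prog_code p) x \<Longrightarrow> \<exists>y. eval A p x y"
    unfolding univ_def by (blast intro: stage_sound)
  show "\<exists>y. eval A p x y \<Longrightarrow> univ A (prog_code p) x"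
    unfolding univ_def using stage_complete eventually_happens'[OF sequentially_bot] by blast
qed

lemma ce_univ_empty: "ce A {} (\<lambda>z. univ A (pfst z) (psnd z))"
  unfolding univ_def by (intro ce_intros ce_dec comp_intros)

lemma ce_univ [ce_intros]:
  assumes "computable A f" "computable A g"
  shows "ce A L (\<lambda>x. univ A (f x) (g x))"
  using ce_compose[OF ce_mono[OF ce_univ_empty], of A "\<lambda>x. pr (f x) (g x)"]
  by (simp add: comp_pr assms)

lemma ce_eval: "ce A {} (\<lambda>x. \<exists>y. eval A p x y)"
  unfolding univ_prog_code[symmetric] by (intro ce_intros comp_intros)

section \<open>Parameters of programs and the Turing jump\<close>

definition fix_code :: "nat \<Rightarrow> nat \<Rightarrow> nat" where
  "fix_code c a = pr 6 (pr c (pr 5 (pr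
     (rec_nat (pr 0 0) (\<lambda>_ d. pr 6 (pr (pr 1 0) d)) a) (prog_code (Tup Fst Snd)))))"

text \<open>Fixing the first argument acts on codes by primitive recursion, since the code of
  \<open>const_prog a\<close> arises by iterating a single operation on codes.\<close>

lemma fix_code: "fix_code (prog_code p) a = prog_code (Comp p (Tup (const_prog a) (Tup Fst Snd)))"
proof -
  have "rec_nat (pr 0 0) (\<lambda>_ d. pr 6 (pr (pr 1 0) d)) a = prog_code (const_prog a)"
    by (induction a) (simp_all add: pr_def)
  then show ?thesis by (simp add: fix_code_def pr_def)
qed

lemma comp_fix_code [comp_intros]: "computable A f \<Longrightarrow> computable A (\<lambda>x. fix_code c (f x))"
  unfolding fix_code_def by (intro comp_intros)

lemma eval_fix: "eval A (Comp p (Tup (const_prog a) (Tup Fst Snd))) x y \<longleftrightarrow> eval A p (pr a x) y"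
proof -
  have *: "eval A (Tup (const_prog a) (Tup Fst Snd)) x (pr a x)"
    unfolding pr_def by (intro eval_Tup eval_const_prog eval_id)
  show ?thesis
  proof
    assume "eval A (Comp p (Tup (const_prog a) (Tup Fst Snd))) x y"
    then show "eval A p (pr a x) y"
      by (rule eval_elims(7)) (metis * eval_deterministic)
  qed (rule eval_Comp[OF *])
qed

text \<open>The index function is computable from every oracle, so it can be used at all levels of
  the iterated jump.\<close>

lemma smn_empty:
  assumes "ce A {} P"
  shows "\<exists>g. (\<forall>B. computable B g) \<and> (\<forall>a x. univ A (g a) x \<longleftrightarrow> P (pr a x))"
proof -
  obtain p where p: "\<forall>x. P x \<longleftrightarrow> (\<exists>y. eval A p x y)" using ce_empty_prog[OF assms] ..
  have "univ A (fix_code (prog_code p) a) x \<longleftrightarrow> P (pr a x)" for a x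
    by (simp only: fix_code univ_prog_code eval_fix p)
  moreover have "computable B (fix_code (prog_code p))" for B by (intro comp_intros)
  ultimately show ?thesis by blast
qed

lemma dec_jump:
  assumes "ce A {} P"
  shows "decidable (turing_jump A) P"
proof -
  obtain p where p: "\<forall>x. P x \<longleftrightarrow> (\<exists>y. eval A p x y)" using ce_empty_prog[OF assms] ..
  \<comment> \<open>The jump runs a program on its own code. Once \<open>x\<close> is fixed as a
    parameter, \<open>q\<close> discards that input and works like \<open>p\<close> on
    \<open>x\<close>.\<close>
  define q where "q = Comp p Fst"
  have q: "eval A q (pr x z) y \<longleftrightarrow> eval A p x y" for x y z
    unfolding q_def pr_def
    by (metis eval_Comp eval_Fst eval_deterministic eval_elims(7) fst_conv prod_encode_inverse)
  have "P x \<longleftrightarrow> fix_code (prog_code q) x \<in> turing_jump A" for x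
  proof -
    have "fix_code (prog_code q) x \<in> turing_jump A \<longleftrightarrow>
        (\<exists>y. eval A (Comp q (Tup (const_prog x) (Tup Fst Snd))) (fix_code (prog_code q) x) y)"
      unfolding turing_jump_def fix_code by (auto simp del: prog_code.simps dest: injD[OF inj_prog_code])
    then show ?thesis by (simp only: eval_fix q p)
  qed
  moreover have "decidable (turing_jump A) (\<lambda>x. fix_code (prog_code q) x \<in> turing_jump A)"
    by (intro comp_intros)
  ultimately show ?thesis by (simp add: decidable_def)
qed

text \<open>Transfers computations from an oracle to any oracle deciding it, in particular to its
  jump.\<close>

primrec subst_oracle :: "prog \<Rightarrow> prog \<Rightarrow> prog" where
  "subst_oracle r Zero = Zero"
| "subst_oracle r Succ = Succ"
| "subst_oracle r Fst = Fst"
| "subst_oracle r Snd = Snd"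
| "subst_oracle r Oracle = r"
| "subst_oracle r (Tup p q) = Tup (subst_oracle r p) (subst_oracle r q)"
| "subst_oracle r (Comp p q) = Comp (subst_oracle r p) (subst_oracle r q)"
| "subst_oracle r (Prec p q) = Prec (subst_oracle r p) (subst_oracle r q)"
| "subst_oracle r (Mu p) = Mu (subst_oracle r p)"

lemma eval_subst_oracle:
  assumes r: "\<And>x. eval B r x (if x \<in> A then 1 else 0)"
  shows "eval A p x y \<Longrightarrow> eval B (subst_oracle r p) x y"
proof (induction rule: eval.induct)
  case (eval_Oracle x)
  show ?case using r by simp
next
  case (eval_Mu p x k)
  then show ?case by (auto intro: eval.intros)
qed (auto intro: eval.intros)

lemma comp_oracle_mono: "decidable B (\<lambda>x. x \<in> A) \<Longrightarrow> computable A f \<Longrightarrow> computable B f"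
  using eval_subst_oracle unfolding decidable_def computable_def by meson

lemma dec_mem_jump: "decidable (turing_jump A) (\<lambda>x. x \<in> A)"
  by (intro dec_jump ce_dec comp_intros)

lemma comp_jump: "computable A f \<Longrightarrow> computable (turing_jump A) f"
  by (rule comp_oracle_mono[OF dec_mem_jump])

lemma dec_to_jump: "decidable A P \<Longrightarrow> decidable (turing_jump A) P"
  unfolding decidable_def by (rule comp_jump)

text \<open>The \<open>e\<close>-th set enumerable from \<open>A\<close> is read as an enumeration
  operator: a pair \<open>pr x N\<close> puts \<open>x\<close> into the result once the finite set
  coded by \<open>N\<close> lies in \<open>L\<close>.\<close>

definition enumerated :: "nat set \<Rightarrow> nat set \<Rightarrow> nat \<Rightarrow> nat \<Rightarrow> bool" where
  "enumerated A L e x \<longleftrightarrow> (\<exists>N. set_decode N \<subseteq> L \<and> univ A e (pr x N))"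

lemma ce_enum [ce_intros]:
  assumes "computable A f" "computable A g"
  shows "ce A L (\<lambda>x. enumerated A L (f x) (g x))"
  unfolding enumerated_def
  by (intro ce_intros comp_intros comp_compose[OF assms(1)] comp_compose[OF assms(2)])

lemma smn:
  assumes "ce A L P"
  shows "\<exists>g. (\<forall>B. computable B g) \<and> (\<forall>a x. enumerated A L (g a) x \<longleftrightarrow> P (pr a x))"
  using assms
proof (rule ceE)
  fix R
  assume R: "decidable A (\<lambda>z. R (pfst z) (pfst (psnd z)) (psnd (psnd z)))"
    and P: "\<And>x. P x \<longleftrightarrow> (\<exists>y N. set_decode N \<subseteq> L \<and> R x y N)"
  \<comment> \<open>Only \<open>y\<close> is searched for here; \<open>N\<close> remains part of the
    input, where \<open>enumerated\<close> compares it with \<open>L\<close>.\<close>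
  define Q where "Q z \<longleftrightarrow> (\<exists>y. R (pr (pfst z) (pfst (psnd z))) y (psnd (psnd z)))" for z
  have "decidable A (\<lambda>z. R (pr (pfst (pfst z)) (pfst (psnd (pfst z)))) (psnd z) (psnd (psnd (pfst z))))"
    using dec_compose[OF R, of "\<lambda>z. pr (pr (pfst (pfst z)) (pfst (psnd (pfst z)))) (pr (psnd z) (psnd (psnd (pfst z))))"]
    by (simp add: comp_intros)
  then have "ce A {} Q" unfolding Q_def by (intro ce_intros ce_dec)
  then obtain g where g: "\<forall>B. computable B g" "\<forall>a x. univ A (g a) x \<longleftrightarrow> Q (pr a x)"
    using smn_empty by blast
  have "enumerated A L (g a) x \<longleftrightarrow> P (pr a x)" for a x
    by (auto simp: enumerated_def g(2) P Q_def)
  with g(1) show ?thesis by blast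
qed

lemma ce_index:
  assumes "ce A L P"
  shows "\<exists>e. \<forall>x. enumerated A L e x \<longleftrightarrow> P x"
proof -
  have "ce A L (\<lambda>z. P (psnd z))" by (intro ce_compose[OF assms] comp_intros)
  then obtain g where "\<forall>a x. enumerated A L (g a) x \<longleftrightarrow> P (psnd (pr a x))" using smn by blast
  then show ?thesis by (intro exI[of _ "g 0"]) simp
qed

subsection \<open>Positive and large conditions\<close>

text \<open>A family \<open>V\<close> of sets and a set \<open>D\<close> of codes of finite sets determine the conjunctive normal
  form \<open>\<Inter>N\<in>D. \<Union>s\<in>N. V s\<close>.\<close>

definition box :: "(nat \<Rightarrow> nat \<Rightarrow> bool) \<Rightarrow> nat set \<Rightarrow> nat \<Rightarrow> bool" where
  "box V D x \<longleftrightarrow> (\<forall>N\<in>D. \<exists>s\<in>set_decode N. V s x)"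

text \<open>\<open>Y\<close> is a sequence of reservoirs. If it is shrinking, \<open>Y k\<close> has
  no elements below \<open>k\<close>, so a positive box meets every reservoir in an infinite
  set.\<close>

definition positive :: "(nat \<Rightarrow> nat \<Rightarrow> bool) \<Rightarrow> (nat \<Rightarrow> nat \<Rightarrow> bool) \<Rightarrow> nat set \<Rightarrow> bool" where
  "positive Y V D \<longleftrightarrow> (\<forall>k. \<exists>x. Y k x \<and> box V D x)"

text \<open>The finite intersection property of \<open>\<Phi>\<close> over \<open>D\<close>, with
  positive in place of nonempty.\<close>

definition large :: "(nat \<Rightarrow> nat \<Rightarrow> bool) \<Rightarrow> (nat \<Rightarrow> nat \<Rightarrow> bool) \<Rightarrow> nat set \<Rightarrow> nat set \<Rightarrow> bool" where
  "large Y V D \<Phi> \<longleftrightarrow> (\<forall>E. finite E \<longrightarrow> E \<subseteq> \<Phi> \<longrightarrow> positive Y V (D \<union> E))"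

definition shrinking :: "(nat \<Rightarrow> nat \<Rightarrow> bool) \<Rightarrow> bool" where
  "shrinking Y \<longleftrightarrow> (\<forall>k. (\<exists>x. Y k x) \<and> (\<forall>x. (Y (Suc k) x \<longrightarrow> Y k x) \<and> (Y k x \<longrightarrow> k \<le> x)))"

lemma shrinking_antimono: "shrinking Y \<Longrightarrow> j \<le> k \<Longrightarrow> Y k x \<Longrightarrow> Y j x"
proof -
  assume Y: "shrinking Y" and jk: "j \<le> k" and x: "Y k x"
  from jk x show ?thesis by (induction k rule: dec_induct) (use Y in \<open>auto simp: shrinking_def\<close>)
qed

lemma box_Un: "box V (D \<union> E) x \<longleftrightarrow> box V D x \<and> box V E x"
  by (auto simp: box_def)

lemma box_singleton: "box V {N} x \<longleftrightarrow> (\<exists>s\<in>set_decode N. V s x)"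
  by (simp add: box_def)

lemma positive_antimono: "positive Y V E \<Longrightarrow> D \<subseteq> E \<Longrightarrow> positive Y V D"
  unfolding positive_def box_def by blast

lemma large_positive: "large Y V D \<Phi> \<Longrightarrow> positive Y V D"
  unfolding large_def by (metis Un_empty_right empty_subsetI finite.emptyI)

lemma large_Un: "large Y V D \<Phi> \<Longrightarrow> finite E \<Longrightarrow> E \<subseteq> \<Phi> \<Longrightarrow> large Y V (D \<union> E) \<Phi>"
  unfolding large_def by (metis Un_assoc Un_subset_iff finite_UnI)

text \<open>Otherwise members of \<open>\<Psi>\<close> could be added to \<open>D\<close> one at a
  time with \<open>\<Phi>\<close> staying large, because the first failure would supply a finite
  \<open>E\<close> and the offending \<open>N\<close>. Then \<open>D\<close> would be large for the
  union as well.\<close>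

lemma large_extend:
  assumes D: "large Y V D \<Phi>" and nl: "\<not> large Y V D (\<Phi> \<union> \<Psi>)"
  shows "\<exists>E N. finite E \<and> large Y V (D \<union> E) \<Phi> \<and> N \<in> \<Psi> \<and> \<not> positive Y V (D \<union> E \<union> {N})"
proof (rule ccontr)
  assume neg: "\<not> ?thesis"
  have "large Y V (D \<union> F) \<Phi>" if "finite F" "F \<subseteq> \<Psi>" for F
    using that
  proof (induction F)
    case empty
    show ?case using D by simp
  next
    case (insert N F)
    then have IH: "large Y V (D \<union> F) \<Phi>" by simp
    show ?case
    proof (rule ccontr)
      assume "\<not> large Y V (D \<union> insert N F) \<Phi>"
      then obtain E where E: "finite E" "E \<subseteq> \<Phi>" "\<not> positive Y V (D \<union> insert N F \<union> E)"
        unfolding large_def by blast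
      have "D \<union> insert N F \<union> E = D \<union> (F \<union> E) \<union> {N}" by blast
      with E large_Un[OF IH E(1,2)] neg insert show False
        by (metis Un_assoc finite_UnI insert_subset)
    qed
  qed
  moreover obtain E where E: "finite E" "E \<subseteq> \<Phi> \<union> \<Psi>" "\<not> positive Y V (D \<union> E)"
    using nl unfolding large_def by blast
  ultimately have "large Y V (D \<union> (E \<inter> \<Psi>)) \<Phi>" by simp
  then have "positive Y V (D \<union> (E \<inter> \<Psi>) \<union> (E - \<Psi>))"
    using E unfolding large_def by blast
  moreover have "D \<union> (E \<inter> \<Psi>) \<union> (E - \<Psi>) = D \<union> E" by blast
  ultimately show False using E by simp
qed

lemma large_decide:
  assumes D: "large Y V D \<Phi>"
  shows "\<exists>E. finite E \<and> large Y V (D \<union> E) \<Phi> \<and> (N \<in> E \<or> \<not> positive Y V (D \<union> E \<union> {N}))"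
proof (cases "large Y V D (\<Phi> \<union> {N})")
  case True
  then have "large Y V (D \<union> {N}) \<Phi>"
    using large_Un[of Y V D "\<Phi> \<union> {N}" "{N}"] unfolding large_def by blast
  then show ?thesis by (intro exI[of _ "{N}"]) simp
next
  case False
  from large_extend[OF D this] show ?thesis by blast
qed

text \<open>One stage of the construction: either the promise \<open>i\<close> is added to
  \<open>K\<close>, or a member of \<open>\<Phi> i\<close> is made non-positive. Deciding
  \<open>M\<close> afterwards does no harm, since non-positivity passes to larger
  conditions.\<close>

lemma large_step:
  assumes "large Y V D (\<Union>e\<in>K. \<Phi> e)"
  shows "\<exists>E K'. finite E \<and> large Y V (D \<union> E) (\<Union>e\<in>K'. \<Phi> e) \<and>
    (K' = insert i K \<or> K' = K \<and> (\<exists>N\<in>\<Phi> i. \<not> positive Y V (D \<union> E \<union> {N}))) \<and>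
    (M \<in> E \<or> \<not> positive Y V (D \<union> E \<union> {M}))"
proof -
  obtain E K' where E: "finite E" "large Y V (D \<union> E) (\<Union>e\<in>K'. \<Phi> e)"
    and K': "K' = insert i K \<or> K' = K \<and> (\<exists>N\<in>\<Phi> i. \<not> positive Y V (D \<union> E \<union> {N}))"
  proof (cases "large Y V D ((\<Union>e\<in>K. \<Phi> e) \<union> \<Phi> i)")
    case True
    then show thesis using that[of "{}" "insert i K"] by (simp add: Un_commute)
  next
    case False
    with large_extend[OF assms] show thesis using that[of _ K] by blast
  qed
  obtain F where F: "finite F" "large Y V (D \<union> E \<union> F) (\<Union>e\<in>K'. \<Phi> e)"
    "M \<in> F \<or> \<not> positive Y V (D \<union> E \<union> F \<union> {M})"
    using large_decide[OF E(2)] by blast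
  have "K' = insert i K \<or> K' = K \<and> (\<exists>N\<in>\<Phi> i. \<not> positive Y V (D \<union> (E \<union> F) \<union> {N}))"
    using K' positive_antimono[of Y V "D \<union> (E \<union> F) \<union> {_}" "D \<union> E \<union> {_}"] by blast
  with E F show ?thesis by (intro exI[of _ "E \<union> F"] exI[of _ K']) (auto simp: Un_assoc)
qed

subsection \<open>The generic extension\<close>

text \<open>For \<open>J\<close> the jump of \<open>A\<close> this is a form of lowness of
  \<open>L\<close>; by \<open>dec_jump\<close> it holds for empty \<open>L\<close>.\<close>

definition decides :: "nat set \<Rightarrow> nat set \<Rightarrow> nat set \<Rightarrow> bool" where
  "decides J A L \<longleftrightarrow> (\<forall>P. ce A L P \<longrightarrow> decidable J P)"

text \<open>States of the construction are triples of a code \<open>D\<close> of a condition, a code \<open>K\<close> of a finite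
  set of promises (the elements of \<open>L'\<close> must not include any set enumerated by a promise), and an
  index \<open>k\<close> into the sequence of reservoirs.\<close>

lemma generic_extension:
  fixes A L J J'
  defines "J \<equiv> turing_jump A" and "J' \<equiv> turing_jump (turing_jump A)"
  assumes low: "decides J A L"
    and Q: "ce A L Q" and y: "computable J y" and Y: "shrinking (\<lambda>k x. Q (pr (y k) x))"
  shows "\<exists>L' Q' y'. decides J' J L' \<and> ce J L' Q' \<and> computable J' y' \<and>
    shrinking (\<lambda>k x. Q' (pr (y' k) x)) \<and> (\<forall>k x. Q' (pr (y' k) x) \<longrightarrow> Q (pr (y k) x)) \<and>
    (\<forall>s k x. s < k \<longrightarrow> Q' (pr (y' k) x) \<longrightarrow> (enumerated A L s x \<longleftrightarrow> s \<notin> L'))"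
proof -
  define V where "V = enumerated A L"
  define Yk where "Yk k x \<longleftrightarrow> Q (pr (y k) x)" for k x
  \<comment> \<open>An \<open>N\<close> in \<open>\<Phi> e\<close> codes a finite set that
    \<open>L'\<close> might include. As a clause of a condition it stands for the union of the
    \<open>V s\<close> with \<open>s\<close> in that set.\<close>
  define \<Phi> where "\<Phi> e = {N. univ J e N}" for e
  define pos where "pos D E \<longleftrightarrow> positive Yk V (set_decode D \<union> set_decode E)" for D E
  define lg where "lg D K \<longleftrightarrow> large Yk V (set_decode D) (\<Union>e\<in>set_decode K. \<Phi> e)" for D K
  define meets where "meets k D E \<longleftrightarrow> (\<exists>x. Yk k x \<and> box V (set_decode D) x \<and> box V (set_decode E) x)" for k D E
  have shr: "shrinking Yk" using Y by (simp add: Yk_def[abs_def])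

  have ceJ: "ce J {} P \<Longrightarrow> decidable J' P" for P
    unfolding J_def J'_def by (rule dec_jump)
  have JJ': "decidable J P \<Longrightarrow> decidable J' P" "computable J f \<Longrightarrow> computable J' f" for P f
    unfolding J_def J'_def by (rule dec_to_jump comp_jump; assumption)+
  have y': "computable J' y" by (rule JJ'(2)[OF y])

  have ce_box: "ce A L (\<lambda>z. box V (set_decode (f z)) (g z))" if "computable A f" "computable A g" for f g
    unfolding box_def V_def
    by (intro ce_intros comp_intros that comp_compose[OF that(1)] comp_compose[OF that(2)])
  have ce_Q: "ce A L (\<lambda>z. Q (f z))" if "computable A f" for f by (rule ce_compose[OF Q that])

  have dec_meets: "decidable J (\<lambda>z. meets (k z) (D z) (E z))"
    if "computable J k" "computable J D" "computable J E" for k D E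
  proof -
    \<comment> \<open>\<open>y\<close> is only computable from \<open>J\<close>, so its values are
      substituted after \<open>low\<close> has been applied to a statement enumerable from
      \<open>A\<close> and \<open>L\<close>.\<close>
    define M where "M z \<longleftrightarrow> (\<exists>x. Q (pr (pfst z) x) \<and> box V (set_decode (pfst (psnd z))) x
      \<and> box V (set_decode (psnd (psnd z))) x)" for z
    have "ce A L M" unfolding M_def by (intro ce_intros ce_Q ce_box comp_intros)
    then have "decidable J M" using low unfolding decides_def by blast
    then have "decidable J (\<lambda>z. M (pr (y (k z)) (pr (D z) (E z))))"
      by (rule dec_compose) (intro comp_intros comp_compose[OF y] that)
    then show ?thesis by (simp add: M_def meets_def Yk_def)
  qed
  have pos_iff: "\<not> pos D E \<longleftrightarrow> (\<exists>k. \<not> meets k D E)" for D E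
    unfolding pos_def positive_def box_Un meets_def by blast
  have ce_npos: "ce J {} (\<lambda>z. \<not> pos (D z) (E z))" if "computable J D" "computable J E" for D E
    unfolding pos_iff
    by (intro ce_intros ce_dec comp_intros dec_meets comp_compose[OF that(1)] comp_compose[OF that(2)])
  \<comment> \<open>Quantifying over codes of finite subsets makes failure of largeness enumerable
    from \<open>J\<close>, hence decidable from \<open>J'\<close>.\<close>
  have lg_iff: "\<not> lg D K \<longleftrightarrow> (\<exists>E. (\<forall>N\<in>set_decode E. \<exists>e\<in>set_decode K. univ J e N) \<and> \<not> pos D E)" for D K
  proof -
    have "\<not> lg D K \<longleftrightarrow> (\<exists>E. finite E \<and> E \<subseteq> (\<Union>e\<in>set_decode K. \<Phi> e) \<and>
        \<not> positive Yk V (set_decode D \<union> E))"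
      unfolding lg_def large_def by blast
    also have "\<dots> \<longleftrightarrow> (\<exists>E. set_decode E \<subseteq> (\<Union>e\<in>set_decode K. \<Phi> e) \<and> \<not> pos D E)"
      unfolding pos_def by (metis finite_set_decode set_encode_inverse)
    finally show ?thesis by (simp add: subset_iff \<Phi>_def Ball_def)
  qed
  have ce_nlg: "ce J {} (\<lambda>z. \<not> lg (D z) (K z))" if "computable J D" "computable J K" for D K
    unfolding lg_iff
    by (intro ce_intros ce_npos comp_intros comp_compose[OF that(1)] comp_compose[OF that(2)])
  have dec_lg: "decidable J' (\<lambda>z. lg (D z) (K z))" if "computable J' D" "computable J' K" for D K
  proof -
    have "decidable J' (\<lambda>z. \<not> lg (pfst z) (psnd z))" by (intro ceJ ce_nlg comp_intros)
    then have "decidable J' (\<lambda>z. \<not> \<not> lg (pfst z) (psnd z))" by (rule dec_not)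
    from dec_compose[OF this comp_pr[OF that]] show ?thesis by simp
  qed
  have dec_meets': "decidable J' (\<lambda>z. meets (k z) (D z) (E z))"
    if "computable J' k" "computable J' D" "computable J' E" for k D E
  proof -
    have "decidable J' (\<lambda>z. meets (pfst z) (pfst (psnd z)) (psnd (psnd z)))"
      by (intro JJ' dec_meets comp_intros)
    from dec_compose[OF this comp_pr[OF that(1) comp_pr[OF that(2,3)]]] show ?thesis by simp
  qed
  have dec_hit: "decidable J' (\<lambda>z. \<exists>N. univ J (i z) N \<and> \<not> pos (D z) (2 ^ N))"
    if "computable J' i" "computable J' D" for i D
  proof -
    have "decidable J' (\<lambda>z. \<exists>N. univ J (pfst z) N \<and> \<not> pos (psnd z) (2 ^ N))"
      by (intro ceJ ce_intros ce_npos comp_intros)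
    from dec_compose[OF this comp_pr[OF that]] show ?thesis by simp
  qed

  \<comment> \<open>Stage \<open>i\<close> either makes \<open>i\<close> a promise or makes a member
    of \<open>\<Phi> i\<close> non-positive, and it decides whether to stay in \<open>V i\<close> or
    to avoid it. The code \<open>2 ^ (2 ^ i)\<close> is that of the condition whose only clause is
    the set \<open>V i\<close>. The premise \<open>lg D K\<close> ensures that every state has a
    successor.\<close>
  define S where "S i D K k D' K' k' \<longleftrightarrow> lg D K \<longrightarrow>
      set_decode D \<subseteq> set_decode D' \<and> k \<le> k' \<and> i < k' \<and> lg D' K' \<and>
      (i \<in> set_decode K' \<and> set_decode K \<subseteq> set_decode K' \<and>
         (\<forall>j\<in>set_decode K'. j = i \<or> j \<in> set_decode K) \<or>
       K' = K \<and> (\<exists>N. univ J i N \<and> \<not> pos D' (2 ^ N))) \<and>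
      (2 ^ i \<in> set_decode D' \<or> \<not> meets k' D' (2 ^ (2 ^ i)))" for i D K k D' K' k'
  define P where "P z \<longleftrightarrow> S (pfst z) (pfst (pfst (psnd z))) (pfst (psnd (pfst (psnd z))))
      (psnd (psnd (pfst (psnd z)))) (pfst (psnd (psnd z))) (pfst (psnd (psnd (psnd z))))
      (psnd (psnd (psnd (psnd z))))" for z
  have "decidable J' P"
    unfolding P_def S_def by (intro comp_intros dec_lg dec_meets' dec_hit)
  then have ceP: "ce J' {} P" by (rule ce_dec)
  have S_ex: "\<exists>D' K' k'. S i D K k D' K' k'" for i D K k
  proof (cases "lg D K")
    case True
    obtain E K' where E: "finite E" and l: "large Yk V (set_decode D \<union> E) (\<Union>e\<in>K'. \<Phi> e)"
      and K': "K' = insert i (set_decode K) \<or> K' = set_decode K \<and>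
         (\<exists>N\<in>\<Phi> i. \<not> positive Yk V (set_decode D \<union> E \<union> {N}))"
      and M: "2 ^ i \<in> E \<or> \<not> positive Yk V (set_decode D \<union> E \<union> {2 ^ i})"
      using large_step[OF True[unfolded lg_def], of i "2 ^ i"] by blast
    define D' where "D' = set_encode (set_decode D \<union> E)"
    define K1 where "K1 = set_encode K'"
    have D': "set_decode D' = set_decode D \<union> E" using E by (simp add: D'_def set_encode_inverse)
    have "finite K'" using K' by auto
    then have K1: "set_decode K1 = K'" by (simp add: K1_def set_encode_inverse)
    have "2 ^ i \<in> set_decode D' \<or> \<not> pos D' (2 ^ (2 ^ i))"
      using M by (auto simp: pos_def D')
    then obtain k1 where k1: "2 ^ i \<in> set_decode D' \<or> \<not> meets k1 D' (2 ^ (2 ^ i))"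
      unfolding pos_iff by blast
    \<comment> \<open>A box missed by the reservoir \<open>k1\<close> is missed by all later ones,
      because they shrink.\<close>
    define k' where "k' = Suc (max k1 (max k i))"
    have "2 ^ i \<in> set_decode D' \<or> \<not> meets k' D' (2 ^ (2 ^ i))"
      using k1 shrinking_antimono[OF shr, of k1 k'] unfolding meets_def k'_def by force
    moreover have "K' = set_decode K \<Longrightarrow> K1 = K" by (simp add: K1_def)
    ultimately have "S i D K k D' K1 k'"
      using K' l by (auto simp: S_def lg_def D' K1 pos_def \<Phi>_def k'_def)
    then show ?thesis by blast
  qed (simp add: S_def)
  have "\<exists>v. P (pr i (pr u v))" for i u
  proof -
    obtain D' K' k' where "S i (pfst u) (pfst (psnd u)) (psnd (psnd u)) D' K' k'" using S_ex by blast
    then show ?thesis by (intro exI[of _ "pr D' (pr K' k')"]) (simp add: P_def)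
  qed
  from ce_iterate[OF ceP this, of "pr 0 (pr 0 0)"] obtain f where f: "computable J' f"
    "f 0 = pr 0 (pr 0 0)" "\<And>i. P (pr i (pr (f i) (f (Suc i))))" by blast
  define D where "D i = pfst (f i)" for i
  define K where "K i = pfst (psnd (f i))" for i
  define \<kappa> where "\<kappa> i = psnd (psnd (f i))" for i
  have S: "S i (D i) (K i) (\<kappa> i) (D (Suc i)) (K (Suc i)) (\<kappa> (Suc i))" for i
    using f(3)[of i] by (simp add: P_def D_def K_def \<kappa>_def)
  have lg: "lg (D i) (K i)" for i
  proof (induction i)
    case 0
    have "\<exists>x. Yk k x" for k using shr by (auto simp: shrinking_def)
    then show ?case using f(2) by (simp add: D_def K_def lg_def large_def positive_def box_def)
  next
    case (Suc i)
    with S[of i] show ?case by (simp add: S_def)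
  qed
  have step: "set_decode (D i) \<subseteq> set_decode (D (Suc i))" "\<kappa> i \<le> \<kappa> (Suc i)" "i < \<kappa> (Suc i)"
    "set_decode (K (Suc i)) = insert i (set_decode (K i)) \<or> K (Suc i) = K i \<and> (\<exists>N. univ J i N \<and> \<not> pos (D (Suc i)) (2 ^ N))"
    "2 ^ i \<in> set_decode (D (Suc i)) \<or> \<not> meets (\<kappa> (Suc i)) (D (Suc i)) (2 ^ (2 ^ i))" for i
    using S[of i] lg[of i] unfolding S_def by auto
  have D_mono: "i \<le> j \<Longrightarrow> set_decode (D i) \<subseteq> set_decode (D j)" for i j
    by (rule lift_Suc_mono_le[of "\<lambda>i. set_decode (D i)"]) (use step(1) in auto)
  have \<kappa>_mono: "i \<le> j \<Longrightarrow> \<kappa> i \<le> \<kappa> j" for i j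
    by (rule lift_Suc_mono_le[of \<kappa>]) (use step(2) in auto)
  have "set_decode (K i) \<subseteq> set_decode (K (Suc i))" for i using step(4)[of i] by auto
  then have K_mono: "i \<le> j \<Longrightarrow> set_decode (K i) \<subseteq> set_decode (K j)" for i j
    by (rule lift_Suc_mono_le[of "\<lambda>i. set_decode (K i)"])
  have K_less: "e \<in> set_decode (K i) \<Longrightarrow> e < i" for e i
  proof (induction i)
    case 0
    then show ?case using f(2) by (simp add: K_def)
  next
    case (Suc i)
    with step(4)[of i] show ?case by (auto simp: less_Suc_eq)
  qed
  have posD: "positive Yk V (set_decode (D i))" for i
    using large_positive[OF lg[unfolded lg_def]] .

  define L' where "L' = {s. \<exists>i. \<not> pos (D i) (2 ^ (2 ^ s))}"
  have npos_iff: "\<not> pos E (2 ^ N) \<longleftrightarrow>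
      (\<exists>k. \<forall>x. Yk k x \<longrightarrow> box V (set_decode E) x \<longrightarrow> (\<forall>s\<in>set_decode N. \<not> V s x))" for E N
    unfolding pos_def positive_def box_Un set_decode_power2 box_singleton by blast
  have npos_mono: "\<not> pos (D j) E" if "\<not> pos (D i) E" "i \<le> j" for i j E
    using that positive_antimono[of Yk V] D_mono[OF that(2)] unfolding pos_def by (meson Un_mono subset_refl)
  \<comment> \<open>The members of the finite set are avoided from different stages and reservoir
    indices on. Sums bound these, and from there on the whole union is avoided.\<close>
  have subset_L': "(\<exists>i. \<not> pos (D i) (2 ^ N)) \<longleftrightarrow> set_decode N \<subseteq> L'" for N
  proof
    assume "\<exists>i. \<not> pos (D i) (2 ^ N)"
    then show "set_decode N \<subseteq> L'"
      unfolding L'_def npos_iff set_decode_power2 by blast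
  next
    assume "set_decode N \<subseteq> L'"
    then have "\<forall>s\<in>set_decode N. \<exists>i. \<not> pos (D i) (2 ^ (2 ^ s))" by (auto simp: L'_def)
    then obtain i where i: "\<And>s. s \<in> set_decode N \<Longrightarrow> \<not> pos (D (i s)) (2 ^ (2 ^ s))" by metis
    define m where "m = (\<Sum>s\<in>set_decode N. i s)"
    have "i s \<le> m" if "s \<in> set_decode N" for s
      unfolding m_def using that by (intro member_le_sum) auto
    then have "\<forall>s\<in>set_decode N. \<not> pos (D m) (2 ^ (2 ^ s))" using i npos_mono by blast
    then have "\<forall>s\<in>set_decode N. \<exists>k. \<forall>x. Yk k x \<longrightarrow> box V (set_decode (D m)) x \<longrightarrow> \<not> V s x"
      unfolding npos_iff by simp
    then obtain k where k: "\<And>s x. s \<in> set_decode N \<Longrightarrow> Yk (k s) x \<Longrightarrow> box V (set_decode (D m)) x \<Longrightarrow> \<not> V s x"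
      by metis
    define k' where "k' = (\<Sum>s\<in>set_decode N. k s)"
    have "k s \<le> k'" if "s \<in> set_decode N" for s
      unfolding k'_def using that by (intro member_le_sum) auto
    then have "\<forall>x. Yk k' x \<longrightarrow> box V (set_decode (D m)) x \<longrightarrow> (\<forall>s\<in>set_decode N. \<not> V s x)"
      using k shrinking_antimono[OF shr] by blast
    then show "\<exists>i. \<not> pos (D i) (2 ^ N)" unfolding npos_iff by blast
  qed
  \<comment> \<open>By largeness, a promise \<open>e\<close> keeps every member of
    \<open>\<Phi> e\<close> positive forever. Without the promise, stage \<open>e\<close> has made
    some member non-positive.\<close>
  have hit: "(\<exists>N. set_decode N \<subseteq> L' \<and> univ J e N) \<longleftrightarrow> e \<notin> set_decode (K (Suc e))" for e
  proof
    assume "\<exists>N. set_decode N \<subseteq> L' \<and> univ J e N"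
    then obtain N i where N: "univ J e N" and i: "\<not> pos (D i) (2 ^ N)"
      unfolding subset_L'[symmetric] by blast
    define j where "j = max i (Suc e)"
    have "\<not> pos (D j) (2 ^ N)" by (rule npos_mono[OF i]) (simp add: j_def)
    moreover have "pos (D j) (2 ^ N)" if "e \<in> set_decode (K j)"
    proof -
      have "{N} \<subseteq> (\<Union>e\<in>set_decode (K j). \<Phi> e)" using that N by (auto simp: \<Phi>_def)
      then show ?thesis
        using large_positive[OF large_Un[OF lg[of j, unfolded lg_def], of "{N}"]] by (simp add: pos_def)
    qed
    ultimately show "e \<notin> set_decode (K (Suc e))"
      using K_mono[of "Suc e" j] by (auto simp: j_def)
  next
    assume "e \<notin> set_decode (K (Suc e))"
    with step(4)[of e] show "\<exists>N. set_decode N \<subseteq> L' \<and> univ J e N"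
      unfolding subset_L'[symmetric] by blast
  qed
  have "decidable J' P" if "ce J L' P" for P
    using that
  proof (rule ceE)
    fix R
    assume R: "decidable J (\<lambda>z. R (pfst z) (pfst (psnd z)) (psnd (psnd z)))"
      and P: "\<And>x. P x \<longleftrightarrow> (\<exists>y N. set_decode N \<subseteq> L' \<and> R x y N)"
    \<comment> \<open>\<open>g x\<close> will enumerate the finite sets whose inclusion in
      \<open>L'\<close> makes \<open>P x\<close> true, so stage \<open>g x\<close> decides
      \<open>P x\<close>.\<close>
    define T where "T z \<longleftrightarrow> (\<exists>y. R (pfst z) y (psnd z))" for z
    have "decidable J (\<lambda>z. R (pfst (pfst z)) (psnd z) (psnd (pfst z)))"
      using dec_compose[OF R, of "\<lambda>z. pr (pfst (pfst z)) (pr (psnd z) (psnd (pfst z)))"]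
      by (simp add: comp_intros)
    then have "ce J {} T" unfolding T_def by (intro ce_intros ce_dec)
    then obtain g where g: "\<forall>B. computable B g" "\<forall>a x. univ J (g a) x \<longleftrightarrow> T (pr a x)"
      using smn_empty by blast
    have "P x \<longleftrightarrow> g x \<notin> set_decode (K (Suc (g x)))" for x
      unfolding hit[symmetric] P using g(2) by (auto simp: T_def)
    moreover have "decidable J' (\<lambda>x. g x \<notin> set_decode (K (Suc (g x))))"
      unfolding K_def by (intro comp_intros comp_compose[OF f(1)] g(1)[rule_format])
    ultimately show ?thesis by (simp add: decidable_def)
  qed
  then have decides: "decides J' J L'" by (simp add: decides_def)

  \<comment> \<open>The new reservoirs are the old ones cut down by the boxes; the new index carries
    the condition along with the old index.\<close>
  define Q' where "Q' z \<longleftrightarrow> Q (pr (psnd (pfst z)) (psnd z)) \<and> box V (set_decode (pfst (pfst z))) (psnd z)" for z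
  define y'' where "y'' k = pr (D k) (y (\<kappa> k))" for k
  have Q': "Q' (pr (y'' k) x) \<longleftrightarrow> Yk (\<kappa> k) x \<and> box V (set_decode (D k)) x" for k x
    by (simp add: Q'_def y''_def Yk_def)
  have "ce A L Q'" unfolding Q'_def by (intro ce_intros ce_Q ce_box comp_intros)
  then have ceQ': "ce J L' Q'" using low unfolding decides_def by (blast intro: ce_dec)
  have y'': "computable J' y''"
    unfolding y''_def D_def \<kappa>_def by (intro comp_intros comp_compose[OF y'] comp_compose[OF f(1)])
  have \<kappa>_ge: "k \<le> \<kappa> k" for k using step(3)[of "k - 1"] by (cases k) auto
  have box_mono: "i \<le> j \<Longrightarrow> box V (set_decode (D j)) x \<Longrightarrow> box V (set_decode (D i)) x" for i j x
    using D_mono[of i j] unfolding box_def by blast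
  have shr': "shrinking (\<lambda>k x. Q' (pr (y'' k) x))"
    unfolding shrinking_def Q'
  proof (intro allI conjI impI)
    fix k x
    show "\<exists>x. Yk (\<kappa> k) x \<and> box V (set_decode (D k)) x" using posD[of k] by (simp add: positive_def)
    show "Yk (\<kappa> k) x" if "Yk (\<kappa> (Suc k)) x \<and> box V (set_decode (D (Suc k))) x"
      using that shrinking_antimono[OF shr step(2)[of k]] by blast
    show "box V (set_decode (D k)) x" if "Yk (\<kappa> (Suc k)) x \<and> box V (set_decode (D (Suc k))) x"
      using that box_mono[of k "Suc k"] by simp
    show "k \<le> x" if "Yk (\<kappa> k) x \<and> box V (set_decode (D k)) x"
      using that shr \<kappa>_ge[of k] unfolding shrinking_def by (meson le_trans)
  qed
  have sub: "Yk k x" if "Q' (pr (y'' k) x)" for k x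
    using that shrinking_antimono[OF shr \<kappa>_ge[of k]] unfolding Q' by blast
  have split: "enumerated A L s x \<longleftrightarrow> s \<notin> L'" if "s < k" "Q' (pr (y'' k) x)" for s k x
  proof (cases "2 ^ s \<in> set_decode (D (Suc s))")
    case True
    have "V s x"
      using True box_mono[of "Suc s" k x] that unfolding Q' box_def by force
    moreover have "s \<notin> L'"
    proof
      assume "s \<in> L'"
      then obtain i where i: "\<not> pos (D i) (2 ^ (2 ^ s))" by (auto simp: L'_def)
      define j where "j = max i (Suc s)"
      have "\<not> pos (D j) (2 ^ (2 ^ s))" by (rule npos_mono[OF i]) (simp add: j_def)
      moreover have "set_decode (D j) \<union> {2 ^ s} = set_decode (D j)"
        using True D_mono[of "Suc s" j] by (auto simp: j_def)
      ultimately show False using posD[of j] by (simp add: pos_def)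
    qed
    ultimately show ?thesis by (simp add: V_def)
  next
    case False
    then have no: "\<not> meets (\<kappa> (Suc s)) (D (Suc s)) (2 ^ (2 ^ s))" using step(5)[of s] by blast
    then have "\<not> pos (D (Suc s)) (2 ^ (2 ^ s))" unfolding pos_iff by blast
    then have "s \<in> L'" unfolding L'_def by blast
    moreover have "\<not> V s x"
      using no that box_mono[of "Suc s" k x] shrinking_antimono[OF shr \<kappa>_mono[of "Suc s" k], of x]
      unfolding Q' meets_def by (auto simp: box_singleton)
    ultimately show ?thesis by (simp add: V_def)
  qed
  show ?thesis
    using decides ceQ' y'' shr' sub split unfolding Yk_def by blast
qed

subsection \<open>Sequences that are almost homogeneous\<close>

definition almost_const :: "nat \<Rightarrow> (nat \<Rightarrow> nat) \<Rightarrow> (nat \<Rightarrow> bool) \<Rightarrow> bool" where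
  "almost_const n b P \<longleftrightarrow> (\<exists>k v. \<forall>s. s \<subseteq> b ` {k..} \<longrightarrow> finite s \<longrightarrow> card s = n \<longrightarrow> P (set_encode s) = v)"

text \<open>The greedy choice: membership of \<open>i\<close> in \<open>T\<close> can only change from true to false once
  the membership of all smaller numbers has settled, because the reservoirs shrink.\<close>

lemma cohesive_sequence:
  assumes low: "decides J A L"
    and Q: "ce A L Q" and y: "computable J y" and Y: "shrinking (\<lambda>k x. Q (pr (y k) x))"
  shows "\<exists>b. computable J b \<and> strict_mono b \<and> (\<forall>k. Q (pr (y k) (b k))) \<and>
    (\<forall>P. ce A L P \<longrightarrow> (\<exists>k v. \<forall>j\<ge>k. P (b j) = v))"
proof -
  define V where "V = enumerated A L"
  define Yk where "Yk k x \<longleftrightarrow> Q (pr (y k) x)" for k x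
  define ok where "ok g T i \<longleftrightarrow> (\<exists>x. Yk g x \<and> (\<forall>s\<in>set_decode T. s < i \<longrightarrow> V s x) \<and> V i x)" for g T i
  \<comment> \<open>\<open>T\<close> is the greedy set of indices below \<open>g\<close>, and
    \<open>x\<close> is a point of the reservoir in all the chosen sets. As \<open>ok\<close>
    consults \<open>T\<close> only below \<open>i\<close>, \<open>T\<close> can be built one index
    at a time.\<close>
  define G where "G g T x \<longleftrightarrow> (\<forall>s\<in>set_decode T. s < g) \<and> (\<forall>i<g. i \<in> set_decode T \<longleftrightarrow> ok g T i) \<and>
    Yk g x \<and> (\<forall>s\<in>set_decode T. V s x)" for g T x
  have shr: "shrinking Yk" using Y by (simp add: Yk_def[abs_def])
  have decJ: "ce A L P \<Longrightarrow> decidable J P" for P using low by (simp add: decides_def)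
  have ce_Q: "ce A L (\<lambda>z. Q (f z))" if "computable A f" for f by (rule ce_compose[OF Q that])

  have dec_ok: "decidable J (\<lambda>z. ok (g z) (T z) (i z))"
    if "computable J g" "computable J T" "computable J i" for g T i
  proof -
    define M where "M z \<longleftrightarrow> (\<exists>x. Q (pr (pfst z) x) \<and>
      (\<forall>s\<in>set_decode (pfst (psnd z)). \<not> s < psnd (psnd z) \<or> V s x) \<and> V (psnd (psnd z)) x)" for z
    have "ce A L (\<lambda>z. \<not> f z < g z)" if "computable A f" "computable A g" for f g
      by (intro ce_dec comp_intros that)
    note not_less = this
    have "ce A L M" unfolding M_def V_def by (intro ce_intros ce_Q not_less comp_intros)
    then have "decidable J M" by (rule decJ)
    then have "decidable J (\<lambda>z. M (pr (y (g z)) (pr (T z) (i z))))"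
      by (rule dec_compose) (intro comp_intros comp_compose[OF y] that)
    then show ?thesis by (rule dec_cong) (auto simp: M_def ok_def Yk_def)
  qed
  have dec_Y: "decidable J (\<lambda>z. Yk (g z) (x z))" if "computable J g" "computable J x" for g x
    unfolding Yk_def by (rule dec_compose[OF decJ[OF Q]]) (intro comp_intros comp_compose[OF y] that)
  have dec_V: "decidable J (\<lambda>z. V (s z) (x z))" if "computable J s" "computable J x" for s x
  proof -
    have "decidable J (\<lambda>z. V (pfst z) (psnd z))" unfolding V_def by (intro decJ ce_intros comp_intros)
    from dec_compose[OF this comp_pr[OF that]] show ?thesis by simp
  qed
  have "decidable J (\<lambda>z. G (pfst z) (pfst (psnd z)) (psnd (psnd z)))"
    unfolding G_def by (intro comp_intros dec_ok dec_Y dec_V)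
  then have "ce J {} (\<lambda>z. G (pfst z) (pfst (psnd z)) (psnd (psnd z)))" by (rule ce_dec)
  moreover have "\<exists>z. G g (pfst z) (psnd z)" for g
  proof -
    have "\<exists>T. (\<forall>s\<in>set_decode T. s < m) \<and> (\<forall>i<m. i \<in> set_decode T \<longleftrightarrow> ok g T i) \<and>
      (\<exists>x. Yk g x \<and> (\<forall>s\<in>set_decode T. V s x))" for m
    proof (induction m)
      case 0
      have "\<exists>x. Yk g x" using shr by (simp add: shrinking_def)
      then show ?case by (intro exI[of _ 0]) simp
    next
      case (Suc m)
      then obtain T where T: "\<forall>s\<in>set_decode T. s < m" "\<forall>i<m. i \<in> set_decode T \<longleftrightarrow> ok g T i"
        "\<exists>x. Yk g x \<and> (\<forall>s\<in>set_decode T. V s x)" by blast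
      define T' where "T' = (if ok g T m then set_encode (insert m (set_decode T)) else T)"
      have T': "set_decode T' = (if ok g T m then insert m (set_decode T) else set_decode T)"
        by (simp add: T'_def set_encode_inverse)
      have ok: "ok g T' i \<longleftrightarrow> ok g T i" if "i \<le> m" for i
        using that unfolding ok_def T' by auto
      have "i \<in> set_decode T' \<longleftrightarrow> ok g T' i" if "i < Suc m" for i
      proof (cases "i = m")
        case True
        then show ?thesis using ok[of m] T(1) unfolding T' by auto
      next
        case False
        then show ?thesis using ok[of i] T(2) that unfolding T' by auto
      qed
      moreover have "\<exists>x. Yk g x \<and> (\<forall>s\<in>set_decode T'. V s x)"
        using T(1,3) unfolding T' ok_def by auto
      moreover have "\<forall>s\<in>set_decode T'. s < Suc m" using T(1) unfolding T' by (auto simp: less_Suc_eq)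
      ultimately show ?case by blast
    qed
    from this[of g] obtain T x where "G g T x" unfolding G_def by blast
    then show ?thesis by (intro exI[of _ "pr T x"]) simp
  qed
  ultimately obtain h where h: "computable J h" "\<And>g. G g (pfst (h g)) (psnd (h g))"
    using ce_choice[of J "\<lambda>z. G (pfst z) (pfst (psnd z)) (psnd (psnd z))"] by auto
  define T where "T g = set_decode (pfst (h g))" for g
  define f where "f g = psnd (h g)" for g
  have f: "computable J f" unfolding f_def by (intro comp_intros h(1))
  have Yf: "Yk g (f g)" for g using h(2)[of g] by (simp add: G_def f_def)
  have Vf: "s \<in> T g \<Longrightarrow> V s (f g)" for s g using h(2)[of g] by (simp add: G_def f_def T_def)
  have T: "i \<in> T g \<longleftrightarrow> (\<exists>x. Yk g x \<and> (\<forall>s\<in>T g. s < i \<longrightarrow> V s x) \<and> V i x)" if "i < g" for i g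
    using h(2)[of g] that by (simp add: G_def ok_def T_def)

  have settled: "\<exists>g0>e. \<forall>g\<ge>g0. \<forall>i<e. i \<in> T g \<longleftrightarrow> i \<in> T g0" for e
  proof (induction e)
    case 0
    show ?case by auto
  next
    case (Suc e)
    then obtain g0 where g0: "g0 > e" "\<And>g i. g \<ge> g0 \<Longrightarrow> i < e \<Longrightarrow> i \<in> T g \<longleftrightarrow> i \<in> T g0" by blast
    \<comment> \<open>Either \<open>e\<close> stays forever or it is missing at some
      \<open>g1\<close>. Then it cannot return: a point allowing this would already lie in the
      reservoir \<open>g1\<close>, where the choices below \<open>e\<close> are the same.\<close>
    obtain g1 where g1: "g1 \<ge> Suc g0" "(\<forall>g\<ge>Suc g0. e \<in> T g) \<or> e \<notin> T g1" by blast
    have same: "i \<in> T g \<longleftrightarrow> i \<in> T g1" if "g \<ge> g1" "i < e" for g i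
      using g0(2)[of g i] g0(2)[of g1 i] that g1(1) by simp
    have "e \<in> T g \<longleftrightarrow> e \<in> T g1" if g: "g \<ge> g1" for g
    proof (cases "e \<in> T g1")
      case True
      then show ?thesis using g1 g by auto
    next
      case False
      have "e \<notin> T g"
      proof
        assume "e \<in> T g"
        then obtain x where x: "Yk g x" "\<forall>s\<in>T g. s < e \<longrightarrow> V s x" "V e x"
          using T[of e g] g g1(1) g0(1) by auto
        then have "Yk g1 x" using shrinking_antimono[OF shr g] by blast
        moreover have "\<forall>s\<in>T g1. s < e \<longrightarrow> V s x" using x(2) same[OF g] by blast
        ultimately show False using False x(3) T[of e g1] g1(1) g0(1) by auto
      qed
      with False show ?thesis by simp
    qed
    with same have "\<forall>g\<ge>g1. \<forall>i<Suc e. i \<in> T g \<longleftrightarrow> i \<in> T g1"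
      unfolding less_Suc_eq by blast
    moreover have "g1 > Suc e" using g0(1) g1(1) by simp
    ultimately show ?case by blast
  qed
  have conv: "\<exists>g0 v. \<forall>g\<ge>g0. V e (f g) = v" for e
  proof -
    obtain g0 where g0: "g0 > Suc e" "\<forall>g\<ge>g0. \<forall>i<Suc e. i \<in> T g \<longleftrightarrow> i \<in> T g0" using settled by blast
    have "V e (f g) \<longleftrightarrow> e \<in> T g0" if "g \<ge> g0" for g
    proof -
      have "e < g" using that g0(1) by simp
      \<comment> \<open>If \<open>f g\<close> lies in \<open>V e\<close>, it witnesses itself that
        \<open>e\<close> was available to the greedy choice.\<close>
      then have "V e (f g) \<longleftrightarrow> e \<in> T g" using Vf[of _ g] Yf[of g] T[of e g] by blast
      also have "e \<in> T g \<longleftrightarrow> e \<in> T g0" using g0(2) that by blast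
      finally show ?thesis .
    qed
    then show ?thesis by blast
  qed

  \<comment> \<open>Since \<open>g \<le> f g\<close>, restarting just above the previous value makes
    the sequence strictly increasing.\<close>
  define b where "b k = rec_nat (f 0) (\<lambda>_ v. f (Suc v)) k" for k
  have b: "computable J b" unfolding b_def by (intro comp_intros comp_compose[OF f])
  have f_ge: "g \<le> f g" for g using Yf shr by (auto simp: shrinking_def)
  have b_Suc: "b (Suc k) = f (Suc (b k))" for k by (simp add: b_def)
  have mono: "strict_mono b" unfolding strict_mono_Suc_iff b_Suc using f_ge Suc_le_lessD by blast
  have b_f: "\<exists>g\<ge>k. b k = f g" for k
  proof (cases k)
    case 0
    then show ?thesis by (intro exI[of _ 0]) (simp add: b_def)
  next
    case (Suc j)
    then show ?thesis using strict_mono_imp_increasing[OF mono, of j] by (intro exI[of _ "Suc (b j)"]) (simp add: b_Suc)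
  qed
  have "Yk k (b k)" for k
    using b_f[of k] Yf shrinking_antimono[OF shr] by metis
  moreover have "\<exists>k v. \<forall>j\<ge>k. P (b j) = v" if P: "ce A L P" for P
  proof -
    obtain e where e: "\<forall>x. V e x \<longleftrightarrow> P x" using ce_index[OF P] unfolding V_def by blast
    obtain g0 v where "\<forall>g\<ge>g0. V e (f g) = v" using conv by blast
    then have "\<forall>j\<ge>g0. P (b j) = v" using b_f e by (metis le_trans)
    then show ?thesis by blast
  qed
  ultimately show ?thesis using b mono unfolding Yk_def by blast
qed

section \<open>Induction on the size of the colored sets\<close>

lemma set_encode_less_power: "s \<subseteq> {..m} \<Longrightarrow> set_encode s < 2 ^ Suc m"
proof -
  assume "s \<subseteq> {..m}"
  then have "set_encode s \<le> (\<Sum>i<Suc m. 2 ^ i)"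
    unfolding set_encode_def by (intro sum_mono2) (auto simp: lessThan_Suc_atMost)
  also have "(\<Sum>i<k. 2 ^ i) < (2 :: nat) ^ k" for k by (induction k) auto
  finally show ?thesis .
qed

text \<open>A sum bounds the finitely many values concerned at each step. In the application
  \<open>g (pr i \<sigma>)\<close> is an index that must lie below the number of the reservoir
  providing the next point.\<close>

lemma thin_out:
  assumes b: "computable C b" and g: "computable C g"
  shows "\<exists>r. computable C r \<and> strict_mono r \<and>
    (\<forall>k. \<forall>i \<le> b (r k). \<forall>\<sigma> < 2 ^ Suc (b (r k)). g (pr i \<sigma>) < r (Suc k))"
proof -
  define P where "P z \<longleftrightarrow> pfst (psnd z) < psnd (psnd z) \<and>
    (\<forall>i < Suc (b (pfst (psnd z))). \<forall>\<sigma> < 2 ^ Suc (b (pfst (psnd z))). g (pr i \<sigma>) < psnd (psnd z))" for z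
  have "decidable C P"
    unfolding P_def by (intro comp_intros comp_compose[OF b] comp_compose[OF g])
  then have "ce C {} P" by (rule ce_dec)
  moreover have "\<exists>v. P (pr k (pr u v))" for k u
  proof -
    define I where "I = {..<Suc (b u)} \<times> {..<2 ^ Suc (b u) :: nat}"
    define v where "v = Suc (u + (\<Sum>(i, \<sigma>)\<in>I. g (pr i \<sigma>)))"
    have "g (pr i \<sigma>) \<le> (\<Sum>(i, \<sigma>)\<in>I. g (pr i \<sigma>))" if "(i, \<sigma>) \<in> I" for i \<sigma>
      using member_le_sum[of "(i, \<sigma>)" I "\<lambda>(i, \<sigma>). g (pr i \<sigma>)"] that by (auto simp: I_def)
    then have "P (pr k (pr u v))" by (auto simp: P_def v_def I_def le_imp_less_Suc trans_le_add2)
    then show ?thesis ..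
  qed
  ultimately obtain r where r: "computable C r" "\<forall>k. P (pr k (pr (r k) (r (Suc k))))"
    using ce_iterate by blast
  then show ?thesis
    by (intro exI[of _ r]) (auto simp: P_def strict_mono_Suc_iff less_Suc_eq_le)
qed

text \<open>The claim includes that \<open>b k\<close> lies in the \<open>k\<close>-th reservoir
  because the step uses this for the new reservoirs, on which \<open>enumerated A L s\<close> is
  constant from index \<open>Suc s\<close> on.\<close>

lemma almost_homogeneous_sequence:
  assumes "decides (turing_jump A) A L" "ce A L Q" "computable (turing_jump A) y"
    "shrinking (\<lambda>k x. Q (pr (y k) x))"
  shows "\<exists>b. computable ((turing_jump ^^ Suc n) A) b \<and> strict_mono b \<and> (\<forall>k. Q (pr (y k) (b k))) \<and>
    (\<forall>P. ce A L P \<longrightarrow> almost_const (Suc n) b P)"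
  using assms
proof (induction n arbitrary: A L Q y)
  case 0
  then obtain b where b: "computable (turing_jump A) b" "strict_mono b" "\<forall>k. Q (pr (y k) (b k))"
    and P: "\<And>P. ce A L P \<Longrightarrow> \<exists>k v. \<forall>j\<ge>k. P (b j) = v"
    using cohesive_sequence[OF 0] by blast
  have "almost_const 1 b P" if "ce A L P" for P
  proof -
    \<comment> \<open>\<open>2 ^ x\<close> is the code of the singleton of \<open>x\<close>.\<close>
    have "ce A L (\<lambda>x. P (2 ^ x))" by (intro ce_compose[OF that] comp_intros)
    from P[OF this] obtain k v where kv: "\<And>j. j \<ge> k \<Longrightarrow> P (2 ^ b j) = v" by blast
    have "P (set_encode s) = v" if s: "s \<subseteq> b ` {k..}" "card s = 1" for s
    proof -
      obtain j where "s = {b j}" "j \<ge> k" using s by (auto simp: card_1_singleton_iff)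
      then show ?thesis using kv by (simp add: set_encode_def)
    qed
    then show ?thesis unfolding almost_const_def by (intro exI[of _ k] exI[of _ v]) simp
  qed
  with b show ?case by auto
next
  case (Suc n)
  define J where "J = turing_jump A"
  define C where "C = (turing_jump ^^ Suc (Suc n)) A"
  obtain L' Q' y' where gen: "decides (turing_jump J) J L'" "ce J L' Q'"
    "computable (turing_jump J) y'" "shrinking (\<lambda>k x. Q' (pr (y' k) x))"
    and sub: "\<And>k x. Q' (pr (y' k) x) \<Longrightarrow> Q (pr (y k) x)"
    and split: "\<And>s k x. s < k \<Longrightarrow> Q' (pr (y' k) x) \<Longrightarrow> enumerated A L s x \<longleftrightarrow> s \<notin> L'"
    using generic_extension[OF Suc.prems] unfolding J_def by blast
  have "(turing_jump ^^ Suc n) J = C" by (simp add: C_def J_def funpow_swap1)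
  with Suc.IH[OF gen] obtain b where b: "computable C b" "strict_mono b" "\<And>k. Q' (pr (y' k) (b k))"
    and hom: "\<And>P. ce J L' P \<Longrightarrow> almost_const (Suc n) b P" by auto
  \<comment> \<open>For \<open>z = pr (pr i \<sigma>) x\<close> this applies the \<open>i\<close>-th
    relation to the set coded by \<open>\<sigma>\<close> with \<open>x\<close> added, provided that
    \<open>x\<close> is not in it. So \<open>g (pr i \<sigma>)\<close> will index the set of good
    extensions \<open>x\<close> of \<open>\<sigma>\<close>.\<close>
  define R where "R z \<longleftrightarrow> enumerated A L (pfst (pfst z)) (psnd (pfst z) + 2 ^ psnd z)" for z
  have "ce A L R" unfolding R_def by (intro ce_intros comp_intros)
  then obtain g where g: "\<forall>B. computable B g" "\<forall>a x. enumerated A L (g a) x \<longleftrightarrow> R (pr a x)"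
    using smn by blast
  obtain r where r: "computable C r" "strict_mono r"
    "\<And>k i \<sigma>. i \<le> b (r k) \<Longrightarrow> \<sigma> < 2 ^ Suc (b (r k)) \<Longrightarrow> g (pr i \<sigma>) < r (Suc k)"
    using thin_out[OF b(1) g(1)[rule_format]] by blast
  define c where "c k = b (r k)" for k
  have c: "computable C c" unfolding c_def by (intro comp_compose[OF b(1)] r(1))
  have c_mono: "strict_mono c" unfolding c_def using b(2) r(2) by (simp add: strict_mono_def)
  have r_ge: "k \<le> r k" and c_ge: "k \<le> c k" for k
    using strict_mono_imp_increasing r(2) c_mono by blast+
  have Qc: "Q (pr (y k) (c k))" for k
    using shrinking_antimono[OF Suc.prems(4) r_ge[of k]] sub b(3) unfolding c_def by blast
  have "almost_const (Suc (Suc n)) c P" if P: "ce A L P" for P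
  proof -
    obtain i where i: "\<forall>x. enumerated A L i x \<longleftrightarrow> P x" using ce_index[OF P] by blast
    \<comment> \<open>The limit coloring: \<open>\<sigma>\<close> is colored by whether its set of
      good extensions is avoided in the end.\<close>
    have "ce J L' (\<lambda>\<sigma>. g (pr i \<sigma>) \<in> L')"
      by (intro ce_intros comp_compose[OF g(1)[rule_format]] comp_intros)
    from hom[OF this] obtain k v where kv: "\<And>s. s \<subseteq> b ` {k..} \<Longrightarrow> finite s \<Longrightarrow> card s = Suc n \<Longrightarrow>
        (g (pr i (set_encode s)) \<in> L') = v"
      unfolding almost_const_def by blast
    \<comment> \<open>The bound \<open>k\<close> reaches the homogeneous tail of \<open>b\<close>,
      and the bound \<open>i\<close> brings the index \<open>i\<close> within the range covered by
      \<open>r\<close>.\<close>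
    define j0 where "j0 = max k i"
    \<comment> \<open>Splitting off the maximum of \<open>s\<close> reduces its color to the limit
      color of the rest; \<open>v\<close> stands for avoidance, hence the negation.\<close>
    have "P (set_encode s) = (\<not> v)" if s: "s \<subseteq> c ` {j0..}" "finite s" "card s = Suc (Suc n)" for s
    proof -
      define s' where "s' = s - {Max s}"
      have "s \<noteq> {}" using s(3) by auto
      then have max: "Max s \<in> s" using s(2) by simp
      then have s': "finite s'" "card s' = Suc n" using s by (auto simp: s'_def)
      obtain j where j: "j \<ge> j0" "Max s = c j" using max s(1) by auto
      have s'c: "\<exists>l\<ge>j0. l < j \<and> x = c l" if "x \<in> s'" for x
      proof -
        have x: "x \<in> s" "x \<noteq> Max s" using that by (auto simp: s'_def)
        then have "x < Max s" using s(2) by (simp add: order.strict_iff_order)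
        moreover obtain l where "l \<ge> j0" "x = c l" using x(1) s(1) by auto
        ultimately show ?thesis using j strict_mono_less[OF c_mono] by auto
      qed
      obtain x where "x \<in> s'" using s'(2) by fastforce
      \<comment> \<open>As \<open>s'\<close> is nonempty, the maximum is not the first point of the
        tail, and all of \<open>s'\<close> lies at or below the point before it.\<close>
      from s'c[OF this] obtain m where m: "j = Suc m" "j0 \<le> m" by (cases j) auto
      have "x \<le> c m" if "x \<in> s'" for x
        using s'c[OF that] m(1) strict_mono_less_eq[OF c_mono] by auto
      then have "set_encode s' < 2 ^ Suc (b (r m))"
        by (intro set_encode_less_power) (auto simp: c_def)
      moreover have "i \<le> b (r m)" using c_ge[of m] m(2) by (simp add: c_def j0_def)
      ultimately have "g (pr i (set_encode s')) < r j" using r(3) m(1) by blast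
      from split[OF this b(3)] have "enumerated A L i (set_encode s' + 2 ^ c j) \<longleftrightarrow> g (pr i (set_encode s')) \<notin> L'"
        using g(2) by (simp add: R_def c_def)
      moreover have "set_encode s' + 2 ^ c j = set_encode s"
        using sum.remove[OF s(2) max, of "(^) (2 :: nat)"] by (simp add: set_encode_def s'_def j(2))
      moreover have "s' \<subseteq> b ` {k..}"
      proof
        fix x assume "x \<in> s'"
        from s'c[OF this] obtain l where l: "j0 \<le> l" "x = c l" by blast
        then have "k \<le> r l" using r_ge[of l] by (simp add: j0_def)
        then show "x \<in> b ` {k..}" by (simp add: l(2) c_def)
      qed
      ultimately show ?thesis using kv[of s'] s' i by simp
    qed
    then show ?thesis unfolding almost_const_def by (intro exI[of _ j0] exI[of _ "\<not> v"]) simp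
  qed
  with c c_mono Qc show ?case unfolding C_def by blast
qed

section \<open>Cohesive sets from the empty oracle\<close>

theorem theorem4p1:
  fixes n :: nat
  assumes "n \<ge> 1"
  shows "\<exists>B. n_cohesive n B \<and> B \<le>\<^sub>T (turing_jump ^^ n) {}"
proof -
  obtain m where n: "n = Suc m" using assms by (cases n) auto
  have "decides (turing_jump {}) {} {}" by (simp add: decides_def dec_jump)
  \<comment> \<open>The initial reservoirs are the final segments of the naturals, indexed by their
    least elements.\<close>
  moreover have "ce {} {} (\<lambda>z. pfst z \<le> psnd z)" by (intro ce_dec comp_intros)
  moreover have "computable (turing_jump {}) (\<lambda>k. k)" by (rule comp_id)
  moreover have "shrinking (\<lambda>k x. pfst (pr k x) \<le> psnd (pr k x))" by (auto simp: shrinking_def)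
  ultimately obtain b where b: "computable ((turing_jump ^^ n) {}) b" "strict_mono b"
    and hom: "\<And>P. ce {} {} P \<Longrightarrow> almost_const n b P"
    using almost_homogeneous_sequence[of "{}" "{}" "\<lambda>z. pfst z \<le> psnd z" "\<lambda>k. k" m] unfolding n by blast
  have "almost_homogeneous n C (range b)" if C: "ce_coloring n C" for C
  proof -
    obtain i p where i: "i \<in> {0, 1}"
      and p: "set_encode ` {s \<in> nsets UNIV n. C s = i} = {x. \<exists>y. eval {} p x y}"
      using C unfolding ce_coloring_def computably_enumerable_def by blast
    obtain k v where kv: "\<And>s. s \<subseteq> b ` {k..} \<Longrightarrow> finite s \<Longrightarrow> card s = n \<Longrightarrow> (\<exists>y. eval {} p (set_encode s) y) = v"
      using hom[OF ce_eval[of "{}" p]] unfolding almost_const_def by blast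
    \<comment> \<open>Color \<open>i\<close> is the enumerable one, and \<open>1 - i\<close> is the
      other of the two colors.\<close>
    have "C s = (if v then i else 1 - i)" if "s \<in> nsets (range b - b ` {..<k}) n" for s
    proof -
      have "range b \<subseteq> b ` {..<k} \<union> b ` {k..}"
        unfolding image_Un[symmetric] by (auto simp: not_less)
      then have "range b - b ` {..<k} \<subseteq> b ` {k..}" by blast
      with that have s: "s \<subseteq> b ` {k..}" "finite s" "card s = n" "s \<in> nsets UNIV n"
        unfolding nsets_def by blast+
      have "set_encode s \<in> set_encode ` {s \<in> nsets UNIV n. C s = i} \<longleftrightarrow> C s = i"
      proof
        assume "set_encode s \<in> set_encode ` {s \<in> nsets UNIV n. C s = i}"
        then show "C s = i"
        proof
          fix s' assume eq: "set_encode s = set_encode s'" and s': "s' \<in> {s \<in> nsets UNIV n. C s = i}"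
          have "finite s'" using s' by (simp add: nsets_def)
          then have "s' = s" using eq s(2) set_encode_inverse by metis
          with s' show "C s = i" by simp
        qed
      next
        assume "C s = i"
        with s(4) show "set_encode s \<in> set_encode ` {s \<in> nsets UNIV n. C s = i}" by simp
      qed
      then have "v \<longleftrightarrow> C s = i" using kv[OF s(1-3)] unfolding p by simp
      moreover have "C s \<in> {0, 1}" using C s(4) by (auto simp: ce_coloring_def)
      ultimately show ?thesis using i by auto
    qed
    then show ?thesis unfolding almost_homogeneous_def
      by (intro exI[of _ "b ` {..<k}"]) blast
  qed
  moreover have "infinite (range b)"
    using strict_mono_imp_inj_on[OF b(2)] by (simp add: finite_image_iff)
  moreover have "range b \<le>\<^sub>T (turing_jump ^^ n) {}"
  proof -
    \<comment> \<open>Since \<open>k \<le> b k\<close>, only the first \<open>Suc x\<close> values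
      can equal \<open>x\<close>.\<close>
    have "decidable ((turing_jump ^^ n) {}) (\<lambda>x. \<exists>k<Suc x. b k = x)"
      by (intro comp_intros comp_compose[OF b(1)])
    moreover have "(\<exists>k<Suc x. b k = x) \<longleftrightarrow> x \<in> range b" for x
      using strict_mono_imp_increasing[OF b(2)] by (auto simp: less_Suc_eq_le)
    ultimately show ?thesis by (simp add: decidable_def computable_def turing_reducible_def)
  qed
  ultimately show ?thesis unfolding n_cohesive_def by blast
qed

end
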